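(* Let $f \in L^{\infty}(\mathbb{R})$ denote a function with $0 \leq f \leq 1$, and consider the model $$dS_0 = \rho\, S_0\, dt,\qquad S_0(0) = M\,(1-f(B(T))),$$ $$d^- S_1 = \mu\, S_1\, dt + \sigma\, S_1\, d^- B(t),\qquad S_1(0) = M f(B(T)),$$ on $[0,T]$, where $d^-$ denotes the Russo-Vallois forward stochastic differential, and set $M^{(\mathrm{RV})}(T) := S_0(T)+S_1(T)$. The optimal investment strategy, i.e. the function $f \in L^\infty(\mathbb{R})$ with $0\le f\le 1$ that maximizes $\mathbb{E}\left[M^{(\mathrm{RV})}(T)\right]$ among all such functions, is $$ f(B(T)) = \mathbf{1}_{\left\{ B(T) > \frac{T}{\sigma}\left(\rho-\mu+\frac{1}{2}\sigma^2\right)\right\}}.$$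
   Context: $\{B(t), t\in[0,T]\}$ is a standard one-dimensional Brownian motion, $T>0$ is a fixed time horizon, and $M,\rho,\mu,\sigma$ are positive constants with $\mu>\rho$ ($M$ is the total initial wealth, $\rho$ the interest rate of the bank account, $\mu$ and $\sigma$ the appreciation rate and the volatility of the stock). Functions in $L^\infty(\mathbb{R})$ are identified when equal Lebesgue-almost everywhere, and $\mathbf{1}_A$ is the indicator of the event $A$. Forward integral: a stochastic process $\{\varphi(t), t\in[a,b]\}$ is forward integrable (in the weak sense) over $[a,b]$ with respect to $B$ if there is a stochastic process $\{I(t), t\in[a,b]\}$ such that $$\sup_{t\in[a,b]}\left|\int_a^t \varphi(s)\,\frac{B(s+\varepsilon)-B(s)}{\varepsilon}\,ds - I(t)\right| \to 0 \quad\text{as } \varepsilon\to 0^+$$ in probability; in that case $\int_a^t \varphi(s)\,d^-B(s) := I(t)$. The equation for $S_0$ is an ordinary differential equation with random initial condition, solved pathwise. The equation for $S_1$ means $S_1(t) = S_1(0) + \mu\int_0^t S_1(s)\,ds + \sigma\int_0^t S_1(s)\,d^-B(s)$, $t\in[0,T]$; this initial value problem is known to possess a unique solution, and $S_1$ denotes this solution. *)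

theory Defs
  imports "HOL-Probability.Probability"
begin

definition process_on :: "'a measure \<Rightarrow> real set \<Rightarrow> (real \<Rightarrow> 'a \<Rightarrow> real) \<Rightarrow> bool" where
  "process_on P I X \<longleftrightarrow> (\<forall>t\<in>I. X t \<in> borel_measurable P)"

definition brownian_motion :: "'a measure \<Rightarrow> real \<Rightarrow> (real \<Rightarrow> 'a \<Rightarrow> real) \<Rightarrow> bool" where
  "brownian_motion P T B \<longleftrightarrow>
     prob_space P \<and>
     process_on P {0..T} B \<and>
     (AE \<omega> in P. B 0 \<omega> = 0) \<and>
     (\<forall>n (t :: nat \<Rightarrow> real).
        (\<forall>i\<le>n. t i \<in> {0..T}) \<and> (\<forall>i<n. t i \<le> t (Suc i)) \<longrightarrow>
        prob_space.indep_vars P (\<lambda>_. borel) (\<lambda>i \<omega>. B (t (Suc i)) \<omega> - B (t i) \<omega>) {..<n}) \<and>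
     (\<forall>s t. 0 \<le> s \<and> s < t \<and> t \<le> T \<longrightarrow>
        distributed P lborel (\<lambda>\<omega>. B t \<omega> - B s \<omega>) (normal_density 0 (sqrt (t - s)))) \<and>
     (AE \<omega> in P. continuous_on {0..T} (\<lambda>t. B t \<omega>))"

text \<open>
  The regularised integrals below evaluate the integrator at \<open>s + \<epsilon>\<close>, which may exceed
  the horizon \<open>T\<close>. As usual in calculus via regularisation, a process on \<open>[0,T]\<close> is
  continued by its value at \<open>T\<close>.
\<close>
definition stopped_at :: "real \<Rightarrow> (real \<Rightarrow> 'a \<Rightarrow> real) \<Rightarrow> real \<Rightarrow> 'a \<Rightarrow> real" where
  "stopped_at T B t = B (min t T)"

text \<open>
  Russo--Vallois forward integral: \<open>I t\<close> is the forward integral of \<open>\<phi>\<close> over \<open>[a,t]\<close>.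
  The supremum over \<open>t\<close> need not be a measurable function of \<open>\<omega>\<close> when \<open>P\<close> is not complete,
  so convergence in probability is expressed with the outer measure of \<open>P\<close>; it coincides with
  \<open>P\<close> on measurable sets.
\<close>
definition has_forward_integral ::
  "'a measure \<Rightarrow> (real \<Rightarrow> 'a \<Rightarrow> real) \<Rightarrow> real \<Rightarrow> real \<Rightarrow>
   (real \<Rightarrow> 'a \<Rightarrow> real) \<Rightarrow> (real \<Rightarrow> 'a \<Rightarrow> real) \<Rightarrow> bool" where
  "has_forward_integral P B a b \<phi> I \<longleftrightarrow>
     process_on P {a..b} \<phi> \<and> process_on P {a..b} I \<and>
     (\<forall>\<epsilon>>0. AE \<omega> in P.
        set_integrable lborel {a..b} (\<lambda>s. \<phi> s \<omega> * ((B (s + \<epsilon>) \<omega> - B s \<omega>) / \<epsilon>))) \<and>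
     (\<forall>\<delta>::real. \<delta> > 0 \<longrightarrow>
        ((\<lambda>\<epsilon>. outer_measure_of P {\<omega> \<in> space P. ennreal \<delta> <
             (SUP t\<in>{a..b}. ennreal
                \<bar>(LINT s:{a..t}|lborel. \<phi> s \<omega> * ((B (s + \<epsilon>) \<omega> - B s \<omega>) / \<epsilon>)) - I t \<omega>\<bar>)})
          \<longlongrightarrow> 0) (at_right 0))"

definition insider_info ::
  "'a measure \<Rightarrow> real \<Rightarrow> (real \<Rightarrow> 'a \<Rightarrow> real) \<Rightarrow> real \<Rightarrow> 'a measure" where
  "insider_info P T B t =
     sigma (space P) {B s -` A \<inter> space P | s A. s \<in> insert T {0..t} \<and> A \<in> sets borel}"

text \<open>
  Solutions of \<open>d\<^sup>-X = \<mu> X dt + \<sigma> X d\<^sup>-B\<close>, \<open>X(0) = \<xi>\<close> on \<open>[0,T]\<close>, where \<open>\<xi>\<close> depends on \<open>B(T)\<close>.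
  Uniqueness for a forward equation is a statement about a class of processes: it is not available
  among arbitrary, freely anticipating processes. The class used here consists of
  the processes adapted, up to null sets, to the filtration of \<open>B\<close> enlarged by the value \<open>B(T)\<close>.
  Continuity of the paths need not be required, since it follows from the equation
  (almost surely).
\<close>
definition solves_forward_eq ::
  "'a measure \<Rightarrow> real \<Rightarrow> (real \<Rightarrow> 'a \<Rightarrow> real) \<Rightarrow> real \<Rightarrow> real \<Rightarrow> ('a \<Rightarrow> real) \<Rightarrow>
   (real \<Rightarrow> 'a \<Rightarrow> real) \<Rightarrow> bool" where
  "solves_forward_eq P T B \<mu> \<sigma> \<xi> X \<longleftrightarrow>
     process_on P {0..T} X \<and>
     (\<forall>t\<in>{0..T}. \<exists>Y \<in> borel_measurable (insider_info P T B t). AE \<omega> in P. X t \<omega> = Y \<omega>) \<and>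
     (AE \<omega> in P. X 0 \<omega> = \<xi> \<omega>) \<and>
     (AE \<omega> in P. set_integrable lborel {0..T} (\<lambda>s. X s \<omega>)) \<and>
     (\<exists>I. has_forward_integral P (stopped_at T B) 0 T X I \<and>
        (AE \<omega> in P. \<forall>t\<in>{0..T}.
           X t \<omega> = X 0 \<omega> + \<mu> * (LINT s:{0..t}|lborel. X s \<omega>) + \<sigma> * I t \<omega>))"

definition unique_solution_forward_eq ::
  "'a measure \<Rightarrow> real \<Rightarrow> (real \<Rightarrow> 'a \<Rightarrow> real) \<Rightarrow> real \<Rightarrow> real \<Rightarrow> ('a \<Rightarrow> real) \<Rightarrow>
   (real \<Rightarrow> 'a \<Rightarrow> real) \<Rightarrow> bool" where
  "unique_solution_forward_eq P T B \<mu> \<sigma> \<xi> X \<longleftrightarrow>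
     solves_forward_eq P T B \<mu> \<sigma> \<xi> X \<and>
     (\<forall>Y. solves_forward_eq P T B \<mu> \<sigma> \<xi> Y \<longrightarrow>
        (AE \<omega> in P. \<forall>t\<in>{0..T}. Y t \<omega> = X t \<omega>))"

definition solves_bank_ode ::
  "'a measure \<Rightarrow> real \<Rightarrow> real \<Rightarrow> ('a \<Rightarrow> real) \<Rightarrow> (real \<Rightarrow> 'a \<Rightarrow> real) \<Rightarrow> bool" where
  "solves_bank_ode P T \<rho> \<xi> X \<longleftrightarrow>
     process_on P {0..T} X \<and>
     (AE \<omega> in P. X 0 \<omega> = \<xi> \<omega> \<and>
        (\<forall>t\<in>{0..T}. ((\<lambda>u. X u \<omega>) has_real_derivative \<rho> * X t \<omega>) (at t within {0..T})))"

text \<open>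
  Representatives of the elements of \<open>L\<^sup>\<infinity>(\<real>)\<close> are taken Borel measurable, so that \<open>f (B T)\<close> is
  a random variable also when \<open>P\<close> is not complete; every class has such a representative, and
  the law of \<open>B T\<close> is absolutely continuous.
\<close>
definition L_infinity :: "(real \<Rightarrow> real) set" where
  "L_infinity = {f \<in> borel_measurable borel. \<exists>C. AE x in lborel. \<bar>f x\<bar> \<le> C}"

definition strategies :: "(real \<Rightarrow> real) set" where
  "strategies = {f \<in> L_infinity. AE x in lborel. 0 \<le> f x \<and> f x \<le> 1}"

definition terminal_wealth ::
  "real \<Rightarrow> (real \<Rightarrow> 'a \<Rightarrow> real) \<Rightarrow> (real \<Rightarrow> 'a \<Rightarrow> real) \<Rightarrow> 'a \<Rightarrow> real" where
  "terminal_wealth T X0 X1 = (\<lambda>\<omega>. X0 T \<omega> + X1 T \<omega>)"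

end

theory Submission
  imports Defs
begin

text \<open>
  Once the stock equation is solved by \<open>S\<^sub>1(t) = M f(B(T)) exp (\<sigma> B(t) + (\<mu> - \<sigma>\<^sup>2/2) t)\<close>,
  the expected terminal wealth is \<open>M e\<^bsup>\<rho>T\<^esup>\<close> plus the integral of \<open>f\<close> against a
  weight which, by tilting the Gaussian density, is positive exactly above the threshold; the
  indicator of the positivity set is therefore the only maximiser up to null sets.

  The factor \<open>M f(B(T))\<close> does not depend on \<open>t\<close> and passes through the forward integral, so the
  solution formula is an Ito formula for the exponential. Its integrand is expanded to second order
  along each path. The only probabilistic input is that the regularised quadratic variation
  over \<open>[0,t]\<close> tends to \<open>t\<close>: its centred second moment is of order \<open>\<epsilon>\<close>, hence convergence is
  almost sure along summable sequences \<open>\<epsilon>\<^sub>n\<close>, and this is enough for convergence in probability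
  as \<open>\<epsilon>\<close> tends to 0. No adaptedness is used, which is why the anticipating factor is harmless.
\<close>

section \<open>Pathwise limits\<close>

text \<open>The hypotheses give \<open>S1 f\<close> only as the unique member of a solution class,
  so it is enough to place the explicit exponential in that class. Its forward integral is not
  guessed either: it is the equation \<open>X = X 0 + \<mu> * (LINT X) + \<sigma> * I\<close> solved
  for \<open>I\<close>, and all analysis goes into showing that the regularised integrals converge
  to this \<open>I\<close>. Two obstacles shape the argument. Convergence must be uniform in time,
  while moment estimates control one time at once; countably many grid times have to suffice. And
  \<open>\<xi> = M * f (B T)\<close> is correlated with the whole path, so moments of the
  regularised integral itself are never taken: moments enter only through the squared increments of
  \<open>B\<close>, and for a fixed path \<open>\<xi>\<close> is just a number scaling the error.
  Summable sequences suffice because a failure of convergence in probability would persist along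
  some \<open>\<epsilon>\<close> values chosen below \<open>(1/2) ^ n\<close>. The threshold is the
  value of \<open>B T\<close> at which stock and bank return the same amount, \<open>\<sigma> * x +
  (\<mu> - \<sigma>\<^sup>2 / 2) * T = \<rho> * T\<close>.\<close>

lemma exp_second_order_bound:
  fixes x :: real
  assumes "\<bar>x\<bar> \<le> 1"
  shows "\<bar>exp x - 1 - x - x\<^sup>2 / 2\<bar> \<le> \<bar>x\<bar> ^ 3"
proof -
  obtain t where t: "\<bar>t\<bar> \<le> \<bar>x\<bar>" "exp x = (\<Sum>m<3. x ^ m / fact m) + exp t / fact 3 * x ^ 3"
    using Maclaurin_exp_le[of x 3] by blast
  have "exp t \<le> exp 1" using t(1) assms by simp
  \<comment> \<open>The Lagrange remainder carries the factor \<open>1 / fact 3 = 1 / 6\<close>, so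
    any bound of \<open>exp 1\<close> by 6 gives leading constant 1.\<close>
  also have "\<dots> \<le> 6" using exp_le by simp
  finally have e: "exp t / 6 \<le> 1" by simp
  have "exp x - 1 - x - x\<^sup>2 / 2 = exp t / 6 * x ^ 3"
    using t(2) by (simp add: numeral_3_eq_3 fact_numeral power2_eq_square)
  then have "\<bar>exp x - 1 - x - x\<^sup>2 / 2\<bar> = exp t / 6 * \<bar>x\<bar> ^ 3"
    by (simp only: abs_mult power_abs abs_divide abs_exp_cancel abs_numeral)
  also have "\<dots> \<le> 1 * \<bar>x\<bar> ^ 3" using e by (intro mult_right_mono) auto
  finally show ?thesis by simp
qed

lemma integrable_continuous_on_UNIV:
  fixes f :: "real \<Rightarrow> real"
  assumes "continuous_on UNIV f"
  shows "f integrable_on {a..b}"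
  using assms by (intro integrable_continuous_real) (auto intro: continuous_on_subset)

lemma integral_abs_le:
  fixes f g :: "real \<Rightarrow> real"
  assumes "continuous_on UNIV f" "continuous_on UNIV g"
    and "\<And>s. s \<in> {a..b} \<Longrightarrow> \<bar>f s\<bar> \<le> g s"
  shows "\<bar>integral {a..b} f\<bar> \<le> integral {a..b} g"
  using integral_norm_bound_integral[of f "{a..b}" g] assms
  by (auto intro: integrable_continuous_on_UNIV)

text \<open>A shift of variable telescopes the integrated difference quotient into the mean of
  \<open>Y\<close> over \<open>[t, t + h]\<close> minus its mean over \<open>[0, h]\<close>. Uniform
  continuity brings both means close to \<open>Y t\<close> and \<open>Y 0\<close> at a rate
  independent of \<open>t\<close>.\<close>

lemma uniform_limit_minuserence_quotient_integral:
  fixes Y :: "real \<Rightarrow> real"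
  assumes cY: "continuous_on UNIV Y" and \<epsilon>: "\<epsilon> \<longlonglongrightarrow> 0" "\<And>n. \<epsilon> n > 0"
  shows "uniform_limit {0..T} (\<lambda>n t. integral {0..t} (\<lambda>s. (Y (s + \<epsilon> n) - Y s) / \<epsilon> n))
           (\<lambda>t. Y t - Y 0) sequentially"
proof (rule uniform_limitI)
  fix e :: real assume e: "e > 0"
  \<comment> \<open>The averaging windows stick out beyond \<open>T\<close> by \<open>h\<close>; the
    extra unit of length is matched by the later condition \<open>h < 1\<close>.\<close>
  have "uniformly_continuous_on {0..T + 1} Y"
    using cY by (intro compact_uniformly_continuous) (auto intro: continuous_on_subset)
  then obtain d where d: "d > 0"
    "\<And>s r. s \<in> {0..T+1} \<Longrightarrow> r \<in> {0..T+1} \<Longrightarrow> dist r s < d \<Longrightarrow> dist (Y r) (Y s) < e / 3"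
    using e unfolding uniformly_continuous_on_def
    by (metis zero_less_divide_iff zero_less_numeral)
  have mean: "\<bar>integral {t..t + h} Y / h - Y t\<bar> \<le> e / 3"
    if "t \<in> {0..T}" "0 < h" "h < d" "h < 1" for t h
  proof -
    have "\<bar>integral {t..t + h} (\<lambda>s. Y s - Y t)\<bar> \<le> integral {t..t+h} (\<lambda>s. e / 3)"
      using that d(2)[of t] cY
      by (intro integral_abs_le) (force simp: dist_real_def intro!: continuous_intros less_imp_le)+
    also have "integral {t..t + h} (\<lambda>s. Y s - Y t) = integral {t..t+h} Y - h * Y t"
      using that cY by (subst integral_diff) (auto intro: integrable_continuous_on_UNIV)
    finally have *: "\<bar>integral {t..t+h} Y - h * Y t\<bar> \<le> h * (e / 3)" using that by simp
    have "integral {t..t + h} Y / h - Y t = (integral {t..t+h} Y - h * Y t) / h"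
      using that by (simp add: field_simps)
    then have "\<bar>integral {t..t + h} Y / h - Y t\<bar> = \<bar>integral {t..t+h} Y - h * Y t\<bar> / h"
      using that by (simp add: abs_divide)
    also have "\<dots> \<le> e / 3" using * that by (simp add: pos_divide_le_eq mult.commute)
    finally show ?thesis .
  qed
  have "\<forall>\<^sub>F n in sequentially. \<epsilon> n < min d 1"
    using \<epsilon>(1) d(1) by (intro order_tendstoD) auto
  then show "\<forall>\<^sub>F n in sequentially. \<forall>t\<in>{0..T}.
      dist (integral {0..t} (\<lambda>s. (Y (s + \<epsilon> n) - Y s) / \<epsilon> n)) (Y t - Y 0) < e"
  proof eventually_elim
    case (elim n)
    define h where "h = \<epsilon> n"
    have h: "0 < h" "h < d" "h < 1" using elim \<epsilon>(2)[of n] by (auto simp: h_def)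
    show ?case
    proof
      fix t assume t: "t \<in> {0..T}"
      have i: "Y integrable_on {u..v}" for u v using cY by (rule integrable_continuous_on_UNIV)
      have cs: "continuous_on UNIV (\<lambda>s. Y (s + h))"
        by (rule continuous_on_compose2[OF cY]) (auto intro!: continuous_intros)
      have "integral {0..t} (\<lambda>s. Y (s + h) - Y s) = integral {h..t + h} Y - integral {0..t} Y"
        using Henstock_Kurzweil_Integration.integral_shift[of 0 h t Y, unfolded o_def] continuous_on_subset[OF cY, of "{0+h..t+h}"] cs
        by (subst integral_diff) (auto intro!: i integrable_continuous_on_UNIV)
      also have "\<dots> = integral {t..t + h} Y - integral {0..h} Y"
      proof -
        have "integral {0..h} Y + integral {h..t+h} Y = integral {0..t+h} Y"
          using h t by (intro Henstock_Kurzweil_Integration.integral_combine i) auto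
        moreover have "integral {0..t} Y + integral {t..t+h} Y = integral {0..t+h} Y"
          using h t by (intro Henstock_Kurzweil_Integration.integral_combine i) auto
        ultimately show ?thesis by simp
      qed
      finally have "integral {0..t} (\<lambda>s. (Y (s + h) - Y s) / h) - (Y t - Y 0)
        = (integral {t..t + h} Y / h - Y t) - (integral {0..0+h} Y / h - Y 0)"
        unfolding integral_divide by (simp add: diff_divide_distrib)
      moreover have "\<bar>\<dots>\<bar> \<le> e / 3 + e / 3"
        using mean[OF t h] mean[OF _ h, of 0] t by (auto intro!: order.trans[OF abs_triangle_ineq4] add_mono simp del: divide_le_eq_numeral1 le_divide_eq_numeral1)
      ultimately show "dist (integral {0..t} (\<lambda>s. (Y (s + \<epsilon> n) - Y s) / \<epsilon> n)) (Y t - Y 0) < e"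
        using e unfolding dist_real_def h_def by linarith
    qed
  qed
qed

text \<open>
  As \<open>w \<ge> 0\<close>, its integrals are monotone in the upper limit: convergence on the grids
  \<open>T k / N\<close> already gives uniform convergence.
\<close>
lemma uniform_limit_weighted_integral:
  fixes Z :: "real \<Rightarrow> real" and w :: "nat \<Rightarrow> real \<Rightarrow> real"
  assumes T: "T > 0" and cZ: "continuous_on UNIV Z" and cw: "\<And>n. continuous_on UNIV (w n)"
    and w0: "\<And>n s. w n s \<ge> 0"
    and lim: "\<And>k N. k \<le> N \<Longrightarrow> N > 0 \<Longrightarrow>
        (\<lambda>n. integral {0..T * real k / real N} (w n)) \<longlonglongrightarrow> T * real k / real N"
  shows "uniform_limit {0..T} (\<lambda>n t. integral {0..t} (\<lambda>s. Z s * w n s))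
           (\<lambda>t. integral {0..t} Z) sequentially"
proof (rule uniform_limitI)
  fix e :: real assume e: "e > 0"
  have "bounded (Z ` {0..T})"
    using cZ by (intro compact_imp_bounded compact_continuous_image) (auto intro: continuous_on_subset)
  then obtain K where K: "K > 0" "\<And>s. s \<in> {0..T} \<Longrightarrow> \<bar>Z s\<bar> \<le> K"
    by (auto simp: bounded_pos)
  \<comment> \<open>The final error is at most three quarters of \<open>e\<close>: one from the
    oscillation of \<open>Z\<close> inside a cell (\<open>\<eta>\<close>), one from the last,
    incomplete cell (\<open>2 * K * h\<close>), one from the deviation of the cell masses of
    \<open>w n\<close> from \<open>h\<close> (\<open>\<kappa>\<close>).\<close>
  define \<eta> where "\<eta> = e / (8 * T)"
  have \<eta>: "\<eta> > 0" "2 * \<eta> * T = e / 4" using T e by (auto simp: \<eta>_def)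
  have "uniformly_continuous_on {0..T} Z"
    using cZ by (intro compact_uniformly_continuous) (auto intro: continuous_on_subset)
  then obtain d where d: "d > 0"
    "\<And>s r. s \<in> {0..T} \<Longrightarrow> r \<in> {0..T} \<Longrightarrow> dist r s < d \<Longrightarrow> dist (Z r) (Z s) < \<eta>"
    using \<eta> unfolding uniformly_continuous_on_def by metis
  \<comment> \<open>The first bound puts the mesh \<open>T / N\<close> below the modulus
    \<open>d\<close>, the second makes \<open>2 * K * h\<close> at most
    \<open>e / 4\<close>.\<close>
  obtain N :: nat where N: "real N > max (T / d) (8 * K * T / e)"
    using reals_Archimedean2 by blast
  have N0: "N > 0" using N T d(1) by (metis divide_pos_pos gr0I max_less_iff_conj of_nat_0 order.asym)
  define h where "h = T / N"
  define t where "t k = T * real k / N" for k :: nat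
  have h: "0 < h" "h < d" "2 * K * h \<le> e / 4"
    using N N0 T d e K by (auto simp: h_def field_simps)
  have tS: "t (Suc k) = t k + h" for k by (simp add: t_def h_def field_simps add_divide_distrib)
  have t0: "t 0 = 0" and tN: "t N = T" and t_ge: "t k \<ge> 0" for k using N0 T by (auto simp: t_def)
  have t_le: "t k \<le> T" if "k \<le> N" for k
    using that N0 T by (simp add: t_def pos_divide_le_eq mult_left_mono)
  \<comment> \<open>Each of at most \<open>N\<close> full cells contributes
    \<open>(K + \<eta>) * \<kappa>\<close> and the incomplete one \<open>K * \<kappa>\<close>; the
    denominator makes their total \<open>e / 4\<close>.\<close>
  define \<kappa> where "\<kappa> = e / (4 * (N * K + N * \<eta> + K))"
  have D: "N * K + N * \<eta> + K > 0" using K \<eta> by (intro add_nonneg_pos add_nonneg_nonneg) auto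
  then have \<kappa>0: "\<kappa> > 0" and \<kappa>: "(N * K + N * \<eta> + K) * \<kappa> = e / 4"
    using e by (auto simp: \<kappa>_def field_simps)
  have iw: "(w n) integrable_on {u..v}" for n u v using cw by (rule integrable_continuous_on_UNIV)
  define V where "V n u v = integral {u..v} (\<lambda>s. Z s * (w n s - 1))" for n u v
  have cV: "continuous_on UNIV (\<lambda>s. Z s * (w n s - 1))" for n
    using cZ cw by (intro continuous_intros)
  have V_add: "V n u v + V n v x = V n u x" if "u \<le> v" "v \<le> x" for n u v x
    unfolding V_def using that
    by (intro Henstock_Kurzweil_Integration.integral_combine integrable_continuous_on_UNIV cV)
  have "(\<lambda>n. integral {t k..t (Suc k)} (w n)) \<longlonglongrightarrow> h" if "k < N" for k
  proof -
    have "(\<lambda>n. integral {0..t (Suc k)} (w n) - integral {0..t k} (w n)) \<longlonglongrightarrow> t (Suc k) - t k"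
      using that N0 lim[of k N] lim[of "Suc k" N] unfolding t_def by (intro tendsto_diff) auto
    moreover have "integral {0..t (Suc k)} (w n) - integral {0..t k} (w n)
        = integral {t k..t (Suc k)} (w n)" for n
      using Henstock_Kurzweil_Integration.integral_combine[of 0 "t k" "t (Suc k)" "w n"] t_ge[of k] tS[of k] h iw by auto
    ultimately show ?thesis by (simp add: tS)
  qed
  then have "\<forall>\<^sub>F n in sequentially. \<bar>integral {t k..t (Suc k)} (w n) - h\<bar> < \<kappa>" if "k < N" for k
    using that \<kappa>0 by (auto simp: tendsto_iff dist_real_def)
  then have "\<forall>\<^sub>F n in sequentially. \<forall>k\<in>{..<N}. \<bar>integral {t k..t (Suc k)} (w n) - h\<bar> < \<kappa>"
    by (intro eventually_ball_finite) auto
  then show "\<forall>\<^sub>F n in sequentially. \<forall>u\<in>{0..T}.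
      dist (integral {0..u} (\<lambda>s. Z s * w n s)) (integral {0..u} Z) < e"
  proof eventually_elim
    case (elim n)
    have step: "\<bar>V n (t k) (t (Suc k))\<bar> \<le> K * \<kappa> + \<eta> * (2 * h + \<kappa>)" if k: "k < N" for k
    proof -
      have in01: "{t k..t (Suc k)} \<subseteq> {0..T}" using t_ge[of k] t_le[of "Suc k"] k by auto
      have "V n (t k) (t (Suc k)) = integral {t k..t (Suc k)} (\<lambda>s. Z (t k) * (w n s - 1) + (Z s - Z (t k)) * (w n s - 1))"
        unfolding V_def by (simp add: algebra_simps)
      also have "\<dots> = Z (t k) * (integral {t k..t (Suc k)} (w n) - h) +
          integral {t k..t (Suc k)} (\<lambda>s. (Z s - Z (t k)) * (w n s - 1))"
      proof (subst integral_add)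
        show "(\<lambda>s. (Z s - Z (t k)) * (w n s - 1)) integrable_on {t k..t (Suc k)}"
          using cZ cw by (intro integrable_continuous_on_UNIV continuous_intros)
        show "(\<lambda>s. Z (t k) * (w n s - 1)) integrable_on {t k..t (Suc k)}"
          using cw by (intro integrable_continuous_on_UNIV continuous_intros)
        have "integral {t k..t (Suc k)} (\<lambda>s. w n s - 1) = integral {t k..t (Suc k)} (w n) - h"
          using h tS[of k] by (subst integral_diff) (auto intro: iw)
        then show "integral {t k..t (Suc k)} (\<lambda>s. Z (t k) * (w n s - 1)) +
            integral {t k..t (Suc k)} (\<lambda>s. (Z s - Z (t k)) * (w n s - 1)) =
          Z (t k) * (integral {t k..t (Suc k)} (w n) - h) +
          integral {t k..t (Suc k)} (\<lambda>s. (Z s - Z (t k)) * (w n s - 1))" by simp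
      qed
      finally have eq: "V n (t k) (t (Suc k)) = \<dots>" .
      have "\<bar>integral {t k..t (Suc k)} (\<lambda>s. (Z s - Z (t k)) * (w n s - 1))\<bar>
          \<le> integral {t k..t (Suc k)} (\<lambda>s. \<eta> * (w n s + 1))"
      proof (intro integral_abs_le)
        fix s assume s: "s \<in> {t k..t (Suc k)}"
        have "\<bar>Z s - Z (t k)\<bar> \<le> \<eta>"
          using d(2)[of "t k" s] in01 s h tS[of k] by (auto simp: dist_real_def)
        moreover have "\<bar>w n s - 1\<bar> \<le> w n s + 1" using w0[of n s] by auto
        ultimately show "\<bar>(Z s - Z (t k)) * (w n s - 1)\<bar> \<le> \<eta> * (w n s + 1)"
          unfolding abs_mult using \<eta> by (intro mult_mono) auto
      qed (use cZ cw in \<open>auto intro!: continuous_intros\<close>)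
      also have "\<dots> = \<eta> * (integral {t k..t (Suc k)} (w n) + h)"
        using h tS[of k] by (simp add: Henstock_Kurzweil_Integration.integral_add[OF iw integrable_const_ivl] del: content_real_if)
      also have "\<dots> \<le> \<eta> * (2 * h + \<kappa>)"
        using elim[rule_format, of k] k \<eta> by (intro mult_left_mono) (auto simp: abs_less_iff)
      finally have 1: "\<bar>integral {t k..t (Suc k)} (\<lambda>s. (Z s - Z (t k)) * (w n s - 1))\<bar> \<le> \<eta> * (2 * h + \<kappa>)" .
      have "t k \<in> {0..T}" using in01 tS[of k] h by auto
      then have 2: "\<bar>Z (t k) * (integral {t k..t (Suc k)} (w n) - h)\<bar> \<le> K * \<kappa>"
        unfolding abs_mult using elim k K by (intro mult_mono) (auto intro: less_imp_le)
      show ?thesis unfolding eq using 1 2 by linarith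
    qed
    have V_grid: "\<bar>V n 0 (t k)\<bar> \<le> k * (K * \<kappa> + \<eta> * (2 * h + \<kappa>))" if "k \<le> N" for k
      using that
    proof (induction k)
      case 0 show ?case by (simp add: V_def t0)
    next
      case (Suc k)
      have "V n 0 (t (Suc k)) = V n 0 (t k) + V n (t k) (t (Suc k))"
        using V_add[of 0 "t k" "t (Suc k)"] t_ge[of k] tS[of k] h by simp
      then show ?case using Suc step[of k] by (simp add: algebra_simps)
    qed
    show ?case
    proof
      fix u assume u: "u \<in> {0..T}"
      \<comment> \<open>The endpoint \<open>u = T\<close> is treated apart: there
        \<open>u / h\<close> equals \<open>N\<close>, one past the last cell index.\<close>
      obtain k where k: "k < N" "t k \<le> u" "u \<le> t (Suc k)"
      proof (cases "u = T")
        case True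
        then show ?thesis using that[of "N - 1"] N0 tN tS[of "N - 1"] h by auto
      next
        case False
        define k where "k = nat \<lfloor>u / h\<rfloor>"
        have "real k \<le> u / h" "u / h < real k + 1"
          using u h by (auto simp: k_def)
        then have *: "real k * h \<le> u" "u < (real k + 1) * h" using h by (auto simp: field_simps)
        have th: "t j = real j * h" for j by (simp add: t_def h_def)
        have "real k * h < real N * h" using * u False N0 by (auto simp: h_def)
        then have "k < N" using h by simp
        then show ?thesis using that[of k] * th[of k] th[of "Suc k"] by (simp add: add.commute)
      qed
      have "\<bar>V n (t k) u\<bar> \<le> integral {t k..u} (\<lambda>s. K * (w n s + 1))"
        unfolding V_def
      proof (intro integral_abs_le)
        fix s assume s: "s \<in> {t k..u}"
        have "\<bar>Z s\<bar> \<le> K" using s u t_ge[of k] by (intro K) auto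
        moreover have "\<bar>w n s - 1\<bar> \<le> w n s + 1" using w0[of n s] by auto
        ultimately show "\<bar>Z s * (w n s - 1)\<bar> \<le> K * (w n s + 1)"
          unfolding abs_mult using K by (intro mult_mono) auto
      qed (use cV cw in \<open>auto intro!: continuous_intros\<close>)
      \<comment> \<open>Masses are controlled only between grid points, so the incomplete cell is
        enlarged to the full one; the integrand is nonnegative.\<close>
      also have "\<dots> \<le> integral {t k..t (Suc k)} (\<lambda>s. K * (w n s + 1))"
        using k K w0 cw by (intro integral_subset_le integrable_continuous_on_UNIV)
          (auto intro!: continuous_intros mult_nonneg_nonneg add_nonneg_nonneg)
      also have "\<dots> = K * (integral {t k..t (Suc k)} (w n) + h)"
        using h tS[of k] by (simp add: Henstock_Kurzweil_Integration.integral_add[OF iw integrable_const_ivl] del: content_real_if)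
      also have "\<dots> \<le> K * (2 * h + \<kappa>)"
        using elim[rule_format, of k] k K by (intro mult_left_mono) (auto simp: abs_less_iff)
      finally have 1: "\<bar>V n (t k) u\<bar> \<le> K * (2 * h + \<kappa>)" .
      have "\<bar>V n 0 (t k)\<bar> \<le> k * (K * \<kappa> + \<eta> * (2 * h + \<kappa>))" using k by (intro V_grid) auto
      also have "\<dots> \<le> N * (K * \<kappa> + \<eta> * (2 * h + \<kappa>))"
        using k K \<kappa>0 \<eta> h by (intro mult_right_mono) (auto intro!: add_nonneg_nonneg mult_nonneg_nonneg)
      also have "\<dots> = N * K * \<kappa> + N * \<eta> * \<kappa> + 2 * \<eta> * (N * h)" by (simp add: algebra_simps)
      also have "N * h = T" using N0 by (simp add: h_def)
      finally have 2: "\<bar>V n 0 (t k)\<bar> \<le> N * K * \<kappa> + N * \<eta> * \<kappa> + e / 4" using \<eta>(2) by simp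
      have "V n 0 u = V n 0 (t k) + V n (t k) u"
        using V_add[of 0 "t k" u] t_ge[of k] k by simp
      then have "\<bar>V n 0 u\<bar> \<le> (N * K + N * \<eta> + K) * \<kappa> + e / 4 + 2 * K * h"
        using 1 2 by (simp add: algebra_simps)
      also have "\<dots> < e" unfolding \<kappa> using h e by simp
      finally have "\<bar>V n 0 u\<bar> < e" .
      moreover have "V n 0 u = integral {0..u} (\<lambda>s. Z s * w n s) - integral {0..u} Z"
        unfolding V_def right_diff_distrib mult_1_right using cZ cw
        by (intro integral_diff integrable_continuous_on_UNIV continuous_intros)
      ultimately show "dist (integral {0..u} (\<lambda>s. Z s * w n s)) (integral {0..u} Z) < e"
        by (simp add: dist_real_def)
    qed
  qed
qed


text \<open>The bound has the form small factor times \<open>x\<^sup>2 + h\<close> because, for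
  increments \<open>x\<close> over a step \<open>h\<close>, division by \<open>h\<close> leaves
  \<open>x\<^sup>2 / h + 1\<close>, whose time integral stays bounded by the quadratic variation. Of
  the second-order terms only \<open>\<sigma>\<^sup>2 / 2 * x\<^sup>2\<close> has the size of
  \<open>h\<close> and is kept; the mixed term and \<open>c\<^sup>2 * h\<^sup>2 / 2\<close> join the
  remainder.\<close>

lemma exp_increment_remainder_bound:
  fixes \<sigma> c x h \<eta> :: real
  assumes x: "\<bar>x\<bar> \<le> \<eta>" and h: "0 < h" "h \<le> \<eta>" "h \<le> 1" and \<eta>: "(\<bar>\<sigma>\<bar> + \<bar>c\<bar>) * \<eta> \<le> 1"
  shows "\<bar>exp (\<sigma> * x + c * h) - 1 - \<sigma> * x - c * h - \<sigma>\<^sup>2 / 2 * x\<^sup>2\<bar>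
    \<le> \<eta> * (2 * (\<bar>\<sigma>\<bar> + \<bar>c\<bar>) * (\<sigma>\<^sup>2 + c\<^sup>2) + \<bar>\<sigma> * c\<bar> + c\<^sup>2) * (x\<^sup>2 + h)"
proof -
  define y where "y = \<sigma> * x + c * h"
  have \<eta>0: "\<eta> > 0" using h by simp
  have "\<bar>y\<bar> \<le> \<bar>\<sigma>\<bar> * \<bar>x\<bar> + \<bar>c\<bar> * h"
    using abs_triangle_ineq[of "\<sigma> * x" "c * h"] h by (simp add: y_def abs_mult)
  also have "\<dots> \<le> \<bar>\<sigma>\<bar> * \<eta> + \<bar>c\<bar> * \<eta>" using x h by (intro add_mono mult_left_mono) auto
  finally have y: "\<bar>y\<bar> \<le> (\<bar>\<sigma>\<bar> + \<bar>c\<bar>) * \<eta>" by (simp add: algebra_simps)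
  have hh: "h\<^sup>2 \<le> h" using h by (simp add: power2_eq_square mult_left_le)
  have "y\<^sup>2 \<le> 2 * (\<sigma>\<^sup>2 * x\<^sup>2) + 2 * (c\<^sup>2 * h\<^sup>2)"
    using zero_le_power2[of "\<sigma> * x - c * h"] by (simp add: y_def power2_eq_square algebra_simps)
  also have "\<dots> \<le> 2 * ((\<sigma>\<^sup>2 + c\<^sup>2) * (x\<^sup>2 + h))"
  proof -
    have "c\<^sup>2 * h\<^sup>2 \<le> c\<^sup>2 * h" "0 \<le> \<sigma>\<^sup>2 * h" "0 \<le> c\<^sup>2 * x\<^sup>2"
      using hh h by (auto intro: mult_left_mono)
    then show ?thesis unfolding distrib_left distrib_right by linarith
  qed
  finally have y2: "y\<^sup>2 \<le> 2 * ((\<sigma>\<^sup>2 + c\<^sup>2) * (x\<^sup>2 + h))" .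
  have "\<bar>exp y - 1 - y - y\<^sup>2 / 2\<bar> \<le> \<bar>y\<bar> * y\<^sup>2"
    using exp_second_order_bound[of y] y \<eta> by (simp add: power2_eq_square power3_eq_cube mult.assoc)
  also have "\<dots> \<le> ((\<bar>\<sigma>\<bar> + \<bar>c\<bar>) * \<eta>) * (2 * ((\<sigma>\<^sup>2 + c\<^sup>2) * (x\<^sup>2 + h)))"
    using y y2 \<eta>0 by (intro mult_mono) auto
  finally have 1: "\<bar>exp y - 1 - y - y\<^sup>2 / 2\<bar> \<le> \<eta> * (2 * (\<bar>\<sigma>\<bar> + \<bar>c\<bar>) * (\<sigma>\<^sup>2 + c\<^sup>2)) * (x\<^sup>2 + h)"
    by (simp only: mult_ac)
  have "\<bar>\<sigma> * c * x * h\<bar> \<le> \<bar>\<sigma> * c\<bar> * \<eta> * (x\<^sup>2 + h)"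
  proof -
    have "\<bar>\<sigma> * c * x * h\<bar> = \<bar>\<sigma> * c\<bar> * (\<bar>x\<bar> * h)" using h by (simp add: abs_mult)
    also have "\<dots> \<le> \<bar>\<sigma> * c\<bar> * (\<eta> * (x\<^sup>2 + h))"
      using x h \<eta>0 by (intro mult_left_mono mult_mono) auto
    finally show ?thesis by simp
  qed
  moreover have "c\<^sup>2 * h\<^sup>2 / 2 \<le> c\<^sup>2 * \<eta> * (x\<^sup>2 + h)"
  proof -
    have "c\<^sup>2 * h\<^sup>2 / 2 \<le> c\<^sup>2 * (h * h)"
      using zero_le_power2[of "c * h"] by (simp add: power_mult_distrib flip: power2_eq_square)
    also have "c\<^sup>2 * (h * h) \<le> c\<^sup>2 * (\<eta> * (x\<^sup>2 + h))" using h \<eta>0 by (intro mult_left_mono mult_mono) auto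
    finally show ?thesis by simp
  qed
  moreover have "exp (\<sigma> * x + c * h) - 1 - \<sigma> * x - c * h - \<sigma>\<^sup>2 / 2 * x\<^sup>2 =
      (exp y - 1 - y - y\<^sup>2 / 2) + \<sigma> * c * x * h + c\<^sup>2 * h\<^sup>2 / 2"
    by (simp add: y_def power2_eq_square algebra_simps)
  ultimately have "\<bar>exp (\<sigma> * x + c * h) - 1 - \<sigma> * x - c * h - \<sigma>\<^sup>2 / 2 * x\<^sup>2\<bar>
    \<le> \<eta> * (2 * (\<bar>\<sigma>\<bar> + \<bar>c\<bar>) * (\<sigma>\<^sup>2 + c\<^sup>2)) * (x\<^sup>2 + h) + \<bar>\<sigma> * c\<bar> * \<eta> * (x\<^sup>2 + h) + c\<^sup>2 * \<eta> * (x\<^sup>2 + h)"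
    using 1 zero_le_power2[of "c * h"] unfolding power_mult_distrib by linarith
  then show ?thesis by (simp add: algebra_simps)
qed

text \<open>The integrand is dominated by \<open>K * \<eta> * C * (w + 1)\<close> with
  \<open>w\<close> the squared increment over \<open>\<epsilon> n\<close>. Its mass over
  \<open>{0..T}\<close> is eventually below \<open>T + 1\<close>, so the total is at most
  \<open>K * \<eta> * C * (2 * T + 1)\<close>, where \<open>\<eta>\<close> bounds the increments of
  the path and is free to be small.\<close>

lemma uniform_limit_exp_remainder:
  fixes b Y :: "real \<Rightarrow> real"
  assumes cb: "continuous_on UNIV b" and cY: "continuous_on UNIV Y"
    and \<epsilon>: "\<epsilon> \<longlonglongrightarrow> 0" "\<And>n. \<epsilon> n > 0"
    and qv: "(\<lambda>n. integral {0..T} (\<lambda>s. (b (s + \<epsilon> n) - b s)\<^sup>2 / \<epsilon> n)) \<longlonglongrightarrow> T" and T: "T > 0"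
  shows "uniform_limit {0..T} (\<lambda>n t. integral {0..t} (\<lambda>s. Y s *
      ((exp (\<sigma> * (b (s + \<epsilon> n) - b s) + c * \<epsilon> n) - 1 - \<sigma> * (b (s + \<epsilon> n) - b s) - c * \<epsilon> n
        - \<sigma>\<^sup>2 / 2 * (b (s + \<epsilon> n) - b s)\<^sup>2) / \<epsilon> n))) (\<lambda>t. 0) sequentially"
proof (rule uniform_limitI)
  fix e :: real assume e: "e > 0"
  have "bounded (Y ` {0..T})"
    using cY by (intro compact_imp_bounded compact_continuous_image) (auto intro: continuous_on_subset)
  then obtain K where K: "K > 0" "\<And>s. s \<in> {0..T} \<Longrightarrow> \<bar>Y s\<bar> \<le> K"
    by (auto simp: bounded_pos)
  define C where "C = 2 * (\<bar>\<sigma>\<bar> + \<bar>c\<bar>) * (\<sigma>\<^sup>2 + c\<^sup>2) + \<bar>\<sigma> * c\<bar> + c\<^sup>2"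
  have C: "C \<ge> 0" by (auto simp: C_def intro!: add_nonneg_nonneg mult_nonneg_nonneg)
  \<comment> \<open>The first entry keeps the exponent in the range of the Taylor bound, the second
    makes the final estimate at most \<open>e / 2\<close>. The added ones keep the denominators
    positive when \<open>\<sigma>\<close> and \<open>c\<close> vanish.\<close>
  define \<eta> where "\<eta> = min (1 / (\<bar>\<sigma>\<bar> + \<bar>c\<bar> + 1)) (e / (2 * (K * (C + 1) * (2 * T + 1))))"
  have D: "K * (C + 1) * (2 * T + 1) > 0" using K C T by (intro mult_pos_pos) auto
  have \<eta>: "\<eta> > 0" unfolding \<eta>_def using e D by (auto intro!: divide_pos_pos)
  have "(\<bar>\<sigma>\<bar> + \<bar>c\<bar>) * \<eta> \<le> (\<bar>\<sigma>\<bar> + \<bar>c\<bar>) * (1 / (\<bar>\<sigma>\<bar> + \<bar>c\<bar> + 1))"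
    unfolding \<eta>_def by (intro mult_left_mono) auto
  also have "\<dots> \<le> 1"
  proof -
    have "0 < \<bar>\<sigma>\<bar> + \<bar>c\<bar> + 1" by linarith
    then show ?thesis by (simp only: mult_1_right times_divide_eq_right pos_divide_le_eq mult_1_left)
  qed
  finally have \<eta>1: "(\<bar>\<sigma>\<bar> + \<bar>c\<bar>) * \<eta> \<le> 1" .
  have "\<eta> * (K * (C + 1) * (2 * T + 1)) \<le> e / (2 * (K * (C + 1) * (2 * T + 1))) * (K * (C + 1) * (2 * T + 1))"
    unfolding \<eta>_def using D by (intro mult_right_mono) auto
  also have "\<dots> = e / 2" using D by (auto simp: field_simps)
  finally have \<eta>2: "\<eta> * (K * (C + 1) * (2 * T + 1)) \<le> e / 2" .
  have "uniformly_continuous_on {0..T + 1} b"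
    using cb by (intro compact_uniformly_continuous) (auto intro: continuous_on_subset)
  then obtain d where d: "d > 0"
    "\<And>s r. s \<in> {0..T+1} \<Longrightarrow> r \<in> {0..T+1} \<Longrightarrow> dist r s < d \<Longrightarrow> dist (b r) (b s) < \<eta>"
    using \<eta> unfolding uniformly_continuous_on_def by metis
  have "\<forall>\<^sub>F n in sequentially. \<epsilon> n < min (min d 1) \<eta>"
    using \<epsilon>(1) d(1) \<eta> by (intro order_tendstoD) auto
  moreover have "\<forall>\<^sub>F n in sequentially. integral {0..T} (\<lambda>s. (b (s + \<epsilon> n) - b s)\<^sup>2 / \<epsilon> n) < T + 1"
    using qv by (intro order_tendstoD) auto
  ultimately show "\<forall>\<^sub>F n in sequentially. \<forall>t\<in>{0..T}. dist (integral {0..t} (\<lambda>s. Y s *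
      ((exp (\<sigma> * (b (s + \<epsilon> n) - b s) + c * \<epsilon> n) - 1 - \<sigma> * (b (s + \<epsilon> n) - b s) - c * \<epsilon> n
        - \<sigma>\<^sup>2 / 2 * (b (s + \<epsilon> n) - b s)\<^sup>2) / \<epsilon> n))) 0 < e"
  proof eventually_elim
    case (elim n)
    define h where "h = \<epsilon> n"
    have h: "0 < h" "h < d" "h < 1" "h < \<eta>" using elim \<epsilon>(2)[of n] by (auto simp: h_def)
    define \<Delta> where "\<Delta> s = b (s + h) - b s" for s
    define w where "w s = \<Delta> s ^ 2 / h" for s
    have c\<Delta>: "continuous_on UNIV \<Delta>" unfolding \<Delta>_def
      by (intro continuous_intros cb continuous_on_compose2[OF cb]) auto
    then have cw: "continuous_on UNIV w" unfolding w_def using h by (intro continuous_intros) auto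
    have w0: "w s \<ge> 0" for s using h by (simp add: w_def)
    show ?case
    proof
      fix t assume t: "t \<in> {0..T}"
      let ?R = "\<lambda>s. Y s * ((exp (\<sigma> * \<Delta> s + c * h) - 1 - \<sigma> * \<Delta> s - c * h - \<sigma>\<^sup>2 / 2 * (\<Delta> s)\<^sup>2) / h)"
      have "\<bar>integral {0..t} ?R\<bar> \<le> integral {0..t} (\<lambda>s. K * (\<eta> * C) * (w s + 1))"
      proof (intro integral_abs_le)
        show "continuous_on UNIV ?R" using c\<Delta> cY h by (intro continuous_intros) auto
        show "continuous_on UNIV (\<lambda>s. K * (\<eta> * C) * (w s + 1))" using cw by (intro continuous_intros)
        fix s assume s: "s \<in> {0..t}"
        have "\<bar>\<Delta> s\<bar> \<le> \<eta>"
          using d(2)[of s "s + h"] s t h by (auto simp: dist_real_def \<Delta>_def)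
        then have "\<bar>exp (\<sigma> * \<Delta> s + c * h) - 1 - \<sigma> * \<Delta> s - c * h - \<sigma>\<^sup>2 / 2 * (\<Delta> s)\<^sup>2\<bar>
            \<le> \<eta> * C * ((\<Delta> s)\<^sup>2 + h)"
          unfolding C_def using h \<eta>1 by (intro exp_increment_remainder_bound) auto
        then have "\<bar>(exp (\<sigma> * \<Delta> s + c * h) - 1 - \<sigma> * \<Delta> s - c * h - \<sigma>\<^sup>2 / 2 * (\<Delta> s)\<^sup>2) / h\<bar>
            \<le> \<eta> * C * (w s + 1)"
          using h by (simp add: abs_divide w_def field_simps)
        then have "\<bar>?R s\<bar> \<le> K * (\<eta> * C * (w s + 1))"
          unfolding abs_mult using K s t by (intro mult_mono) auto
        then show "\<bar>?R s\<bar> \<le> K * (\<eta> * C) * (w s + 1)" by (simp add: mult_ac)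
      qed
      also have "\<dots> \<le> integral {0..T} (\<lambda>s. K * (\<eta> * C) * (w s + 1))"
        using t K C \<eta> w0 cw by (intro integral_subset_le integrable_continuous_on_UNIV)
          (auto intro!: continuous_intros mult_nonneg_nonneg add_nonneg_nonneg)
      also have "\<dots> = K * (\<eta> * C) * (integral {0..T} w + T)"
        using T Henstock_Kurzweil_Integration.integral_add[OF integrable_continuous_on_UNIV[OF cw] integrable_const_ivl, of 0 T 1]
        by simp
      also have "\<dots> \<le> K * (\<eta> * (C + 1)) * (2 * T + 1)"
        using elim[folded h_def, folded \<Delta>_def, folded w_def] K \<eta> C T w0 integrable_continuous_on_UNIV[OF cw, of 0 T]
        by (intro mult_mono mult_nonneg_nonneg) (auto intro!: integral_nonneg add_nonneg_nonneg)
      also have "K * (\<eta> * (C + 1)) * (2 * T + 1) = \<eta> * (K * (C + 1) * (2 * T + 1))" by simp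
      also have "\<dots> < e" using \<eta>2 e by linarith
      finally show "dist (integral {0..t} (\<lambda>s. Y s *
        ((exp (\<sigma> * (b (s + \<epsilon> n) - b s) + c * \<epsilon> n) - 1 - \<sigma> * (b (s + \<epsilon> n) - b s) - c * \<epsilon> n
        - \<sigma>\<^sup>2 / 2 * (b (s + \<epsilon> n) - b s)\<^sup>2) / \<epsilon> n))) 0 < e"
        by (simp add: h_def \<Delta>_def)
    qed
  qed
qed

text \<open>A pathwise Ito formula. Since \<open>Y (s + \<epsilon> n) = Y s * exp (\<sigma> *
  \<Delta> n s + c * \<epsilon> n)\<close>, the second-order expansion can be solved for the
  first-order term \<open>Y s * \<Delta> n s / \<epsilon> n\<close>; every other term has a known
  uniform limit. The correction recombines as
  \<open>c + \<sigma>\<^sup>2 / 2 = \<mu>\<close>.\<close>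

lemma uniform_limit_forward_integral_exp:
  fixes b :: "real \<Rightarrow> real" and \<mu> \<sigma> :: real
  assumes cb: "continuous_on UNIV b"
    and \<epsilon>: "\<epsilon> \<longlonglongrightarrow> 0" "\<And>n. \<epsilon> n > 0" and T: "T > 0" and \<sigma>: "\<sigma> > 0"
    and qv: "\<And>k N. k \<le> N \<Longrightarrow> N > 0 \<Longrightarrow>
      (\<lambda>n. integral {0..T * real k / real N} (\<lambda>s. (b (s + \<epsilon> n) - b s)\<^sup>2 / \<epsilon> n)) \<longlonglongrightarrow> T * real k / real N"
  defines "Y \<equiv> (\<lambda>s. exp (\<sigma> * b s + (\<mu> - \<sigma>\<^sup>2 / 2) * s))"
  shows "uniform_limit {0..T} (\<lambda>n t. integral {0..t} (\<lambda>s. Y s * ((b (s + \<epsilon> n) - b s) / \<epsilon> n)))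
    (\<lambda>t. (Y t - Y 0 - \<mu> * integral {0..t} Y) / \<sigma>) sequentially"
proof -
  define c where "c = \<mu> - \<sigma>\<^sup>2 / 2"
  define \<Delta> where "\<Delta> n s = b (s + \<epsilon> n) - b s" for n s
  define R where "R n s = (exp (\<sigma> * \<Delta> n s + c * \<epsilon> n) - 1 - \<sigma> * \<Delta> n s - c * \<epsilon> n - \<sigma>\<^sup>2 / 2 * (\<Delta> n s)\<^sup>2) / \<epsilon> n" for n s
  have cY: "continuous_on UNIV Y" unfolding Y_def using cb by (intro continuous_intros)
  have c\<Delta>: "continuous_on UNIV (\<Delta> n)" for n unfolding \<Delta>_def
    by (intro continuous_intros cb continuous_on_compose2[OF cb]) auto
  have \<epsilon>0: "\<epsilon> n \<noteq> 0" for n using \<epsilon>(2)[of n] by simp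
  have cR: "continuous_on UNIV (R n)" for n unfolding R_def using c\<Delta> \<epsilon>0 by (intro continuous_intros) auto
  have cw: "continuous_on UNIV (\<lambda>s. (\<Delta> n s)\<^sup>2 / \<epsilon> n)" for n using c\<Delta> \<epsilon>0 by (intro continuous_intros) auto
  have cS: "continuous_on UNIV (\<lambda>s. Y (s + \<epsilon> n))" for n
    by (intro continuous_on_compose2[OF cY] continuous_intros) auto
  have "uniform_limit {0..T} (\<lambda>n t. integral {0..t} (\<lambda>s. Y s * ((\<Delta> n s)\<^sup>2 / \<epsilon> n)))
      (\<lambda>t. integral {0..t} Y) sequentially"
    using qv \<epsilon>(2) by (intro uniform_limit_weighted_integral T cY cw) (auto simp: \<Delta>_def less_imp_le)
  moreover have "uniform_limit {0..T} (\<lambda>n t. integral {0..t} (\<lambda>s. Y s * R n s)) (\<lambda>t. 0) sequentially"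
    unfolding R_def \<Delta>_def using qv[of 1 1] by (intro uniform_limit_exp_remainder cb cY \<epsilon> T) auto
  moreover note uniform_limit_minuserence_quotient_integral[OF cY \<epsilon>, of T]
  ultimately have "uniform_limit {0..T}
    (\<lambda>n t. (1 / \<sigma>) * (integral {0..t} (\<lambda>s. (Y (s + \<epsilon> n) - Y s) / \<epsilon> n) - c * integral {0..t} Y
       - \<sigma>\<^sup>2 / 2 * integral {0..t} (\<lambda>s. Y s * ((\<Delta> n s)\<^sup>2 / \<epsilon> n)) - integral {0..t} (\<lambda>s. Y s * R n s)))
    (\<lambda>t. (1 / \<sigma>) * (Y t - Y 0 - c * integral {0..t} Y - \<sigma>\<^sup>2 / 2 * integral {0..t} Y - 0)) sequentially"
    by (intro uniform_limit_minus uniform_limit_const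
        bounded_linear.uniform_limit[OF bounded_linear_mult_right])
  moreover have "(1 / \<sigma>) * (integral {0..t} (\<lambda>s. (Y (s + \<epsilon> n) - Y s) / \<epsilon> n) - c * integral {0..t} Y
       - \<sigma>\<^sup>2 / 2 * integral {0..t} (\<lambda>s. Y s * ((\<Delta> n s)\<^sup>2 / \<epsilon> n)) - integral {0..t} (\<lambda>s. Y s * R n s))
     = integral {0..t} (\<lambda>s. Y s * (\<Delta> n s / \<epsilon> n))" (is "?l = _") for n t
  proof -
    have Yinc: "Y (s + \<epsilon> n) = Y s * exp (\<sigma> * \<Delta> n s + c * \<epsilon> n)" for s
      unfolding Y_def \<Delta>_def c_def exp_add[symmetric] by (simp add: algebra_simps)
    have pt: "Y s * (\<Delta> n s / \<epsilon> n) = (1 / \<sigma>) * ((Y (s + \<epsilon> n) - Y s) / \<epsilon> n - c * Y s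
       - \<sigma>\<^sup>2 / 2 * (Y s * ((\<Delta> n s)\<^sup>2 / \<epsilon> n)) - Y s * R n s)" for s
      unfolding Yinc R_def using \<sigma> \<epsilon>0[of n] by (simp add: field_simps)
    show ?thesis unfolding pt integral_mult_right
      using cY cS c\<Delta> cR \<epsilon>0
      by (subst integral_diff, (auto intro!: integrable_continuous_on_UNIV continuous_intros)[2])+ simp
  qed
  moreover have "(1 / \<sigma>) * (Y t - Y 0 - c * integral {0..t} Y - \<sigma>\<^sup>2 / 2 * integral {0..t} Y - 0)
    = (Y t - Y 0 - \<mu> * integral {0..t} Y) / \<sigma>" for t
    using \<sigma> by (simp add: c_def field_simps)
  ultimately show ?thesis unfolding \<Delta>_def by (simp only:)
qed

section \<open>Quadratic variation of Brownian motion\<close>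

text \<open>By continuity the process is the pointwise limit of its values at time rounded down to a
  multiple of \<open>1 / Suc n\<close>. Such a discretisation takes countably many times, hence is
  jointly measurable.\<close>

lemma borel_measurable_continuous_process:
  fixes X :: "real \<Rightarrow> 'a \<Rightarrow> real"
  assumes X[measurable]: "\<And>t. X t \<in> borel_measurable M"
    and cont: "\<And>\<omega>. continuous_on UNIV (\<lambda>t. X t \<omega>)"
  shows "(\<lambda>(\<omega>, t). X t \<omega>) \<in> borel_measurable (M \<Otimes>\<^sub>M borel)"
proof (rule borel_measurable_LIMSEQ_real)
  fix n :: nat
  define g where "g = (\<lambda>x :: 'a \<times> real. \<lfloor>real (Suc n) * snd x\<rfloor>)"
  have "g \<in> measurable (M \<Otimes>\<^sub>M borel) (count_space UNIV)"
    unfolding g_def by measurable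
  then show "(\<lambda>x. X (of_int (g x) / Suc n) (fst x)) \<in> borel_measurable (M \<Otimes>\<^sub>M borel)"
    by (rule measurable_compose_countable[rotated]) measurable
next
  fix x :: "'a \<times> real"
  have "(\<lambda>n. of_int \<lfloor>real (Suc n) * snd x\<rfloor> / real (Suc n)) \<longlonglongrightarrow> snd x"
  proof (rule real_tendsto_sandwich)
    show "\<forall>\<^sub>F n in sequentially. snd x - 1 / real (Suc n) \<le> of_int \<lfloor>real (Suc n) * snd x\<rfloor> / real (Suc n)"
    proof (intro always_eventually allI)
      fix n
      have "real (Suc n) * snd x - 1 \<le> of_int \<lfloor>real (Suc n) * snd x\<rfloor>" by linarith
      then have "(real (Suc n) * snd x - 1) / real (Suc n) \<le> of_int \<lfloor>real (Suc n) * snd x\<rfloor> / real (Suc n)"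
        by (rule divide_right_mono) simp
      then show "snd x - 1 / real (Suc n) \<le> of_int \<lfloor>real (Suc n) * snd x\<rfloor> / real (Suc n)"
        by (simp add: diff_divide_distrib del: of_nat_Suc)
    qed
    show "\<forall>\<^sub>F n in sequentially. of_int \<lfloor>real (Suc n) * snd x\<rfloor> / real (Suc n) \<le> snd x"
    proof (intro always_eventually allI)
      fix n
      show "of_int \<lfloor>real (Suc n) * snd x\<rfloor> / real (Suc n) \<le> snd x"
        by (subst pos_divide_le_eq) (auto simp: mult.commute simp del: of_nat_Suc)
    qed
    show "(\<lambda>n. snd x - 1 / real (Suc n)) \<longlonglongrightarrow> snd x"
      using tendsto_diff[OF tendsto_const LIMSEQ_inverse_real_of_nat, of "snd x"]
      by (simp add: divide_inverse)
  qed simp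
  then have "(\<lambda>n. X (of_int \<lfloor>real (Suc n) * snd x\<rfloor> / real (Suc n)) (fst x)) \<longlonglongrightarrow> X (snd x) (fst x)"
    by (rule continuous_on_tendsto_compose[OF cont]) auto
  then show "(\<lambda>n. X (of_int \<lfloor>real (Suc n) * snd x\<rfloor> / real (Suc n)) (fst x)) \<longlonglongrightarrow> (case x of (\<omega>, t) \<Rightarrow> X t \<omega>)"
    by (simp add: split_beta)
qed

text \<open>Reduces the second moment of a time integral to covariances at pairs of times, where
  independence can act.\<close>

lemma (in prob_space) second_moment_integral:
  fixes H :: "real \<Rightarrow> 'a \<Rightarrow> real"
  assumes meas[measurable]: "(\<lambda>(\<omega>, s). H s \<omega>) \<in> borel_measurable (M \<Otimes>\<^sub>M lborel)"
    and int: "\<And>\<omega>. integrable lborel (\<lambda>s. H s \<omega>)"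
    and supp: "\<And>s \<omega>. s \<notin> {0..t} \<Longrightarrow> H s \<omega> = 0"
    and bound: "\<And>s. s \<in> {0..t} \<Longrightarrow> (\<integral>\<^sup>+\<omega>. (H s \<omega>)\<^sup>2 \<partial>M) \<le> ennreal C" and C: "C \<ge> 0" and t: "t \<ge> 0"
  shows "integrable M (\<lambda>\<omega>. (LINT s|lborel. H s \<omega>)\<^sup>2)"
    and "expectation (\<lambda>\<omega>. (LINT s|lborel. H s \<omega>)\<^sup>2) =
      (LINT s|lborel. LINT r|lborel. expectation (\<lambda>\<omega>. H s \<omega> * H r \<omega>))"
proof -
  interpret pair_sigma_finite M lborel ..
  have Hs[measurable]: "H s \<in> borel_measurable M" for s
  proof -
    have "(\<lambda>\<omega>. (\<lambda>(\<omega>, s). H s \<omega>) (\<omega>, s)) \<in> borel_measurable M" by measurable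
    then show ?thesis by simp
  qed
  define J where "J \<omega> = (LINT s|lborel. H s \<omega>)" for \<omega>
  have J[measurable]: "J \<in> borel_measurable M" unfolding J_def by measurable
  \<comment> \<open>The inequality between \<open>2 * \<bar>x * y\<bar>\<close> and
    \<open>x\<^sup>2 + y\<^sup>2\<close> turns the bound at single times into one for all pairs,
    which supplies the integrability for both uses of Fubini.\<close>
  have HH: "(\<integral>\<^sup>+\<omega>. ennreal \<bar>H s \<omega> * H r \<omega>\<bar> \<partial>M) \<le> ennreal C * indicator {0..t} s * indicator {0..t} r" for s r
  proof (cases "s \<in> {0..t} \<and> r \<in> {0..t}")
    case True
    have "2 * (\<integral>\<^sup>+\<omega>. ennreal \<bar>H s \<omega> * H r \<omega>\<bar> \<partial>M) = (\<integral>\<^sup>+\<omega>. ennreal (2 * \<bar>H s \<omega> * H r \<omega>\<bar>) \<partial>M)"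
      by (subst nn_integral_cmult[symmetric]) (auto simp: ennreal_mult'')
    also have "\<dots> \<le> (\<integral>\<^sup>+\<omega>. ennreal ((H s \<omega>)\<^sup>2) + ennreal ((H r \<omega>)\<^sup>2) \<partial>M)"
    proof (intro nn_integral_mono)
      fix \<omega>
      show "ennreal (2 * \<bar>H s \<omega> * H r \<omega>\<bar>) \<le> ennreal ((H s \<omega>)\<^sup>2) + ennreal ((H r \<omega>)\<^sup>2)"
        using sum_squares_bound[of "\<bar>H s \<omega>\<bar>" "\<bar>H r \<omega>\<bar>"]
        by (auto simp: abs_mult mult.assoc simp flip: ennreal_plus)
    qed
    also have "\<dots> = (\<integral>\<^sup>+\<omega>. (H s \<omega>)\<^sup>2 \<partial>M) + (\<integral>\<^sup>+\<omega>. (H r \<omega>)\<^sup>2 \<partial>M)"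
      by (subst nn_integral_add) auto
    also have "\<dots> \<le> ennreal C + ennreal C" using True by (intro add_mono bound) auto
    also have "\<dots> = 2 * ennreal C" by (simp add: mult_2)
    finally show ?thesis using True by (simp add: ennreal_mult_le_mult_iff)
  qed (auto simp: supp)
  have fin: "ennreal C * ennreal t < \<infinity>" "ennreal C * ennreal t * ennreal t < \<infinity>"
    by (auto simp: ennreal_mult_less_top)
  have ind: "(\<integral>\<^sup>+s. indicator {0..t} s \<partial>lborel) = ennreal t" using t by simp
  have g: "integrable (M \<Otimes>\<^sub>M lborel) (\<lambda>(\<omega>, r). H s \<omega> * H r \<omega>)" for s
  proof (rule integrableI_bounded)
    have "(\<integral>\<^sup>+x. ennreal (norm (case x of (\<omega>, r) \<Rightarrow> H s \<omega> * H r \<omega>)) \<partial>(M \<Otimes>\<^sub>M lborel))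
      = (\<integral>\<^sup>+r. (\<integral>\<^sup>+\<omega>. ennreal \<bar>H s \<omega> * H r \<omega>\<bar> \<partial>M) \<partial>lborel)"
      by (subst nn_integral_snd[symmetric]) auto
    also have "\<dots> \<le> (\<integral>\<^sup>+r. ennreal C * indicator {0..t} r \<partial>lborel)"
      by (intro nn_integral_mono order.trans[OF HH]) (auto split: split_indicator)
    also have "\<dots> = ennreal C * ennreal t" by (simp add: nn_integral_cmult ind)
    finally show "(\<integral>\<^sup>+x. ennreal (norm (case x of (\<omega>, r) \<Rightarrow> H s \<omega> * H r \<omega>)) \<partial>(M \<Otimes>\<^sub>M lborel)) < \<infinity>"
      using fin(1) by (rule le_less_trans)
  qed measurable
  have f: "integrable (M \<Otimes>\<^sub>M lborel) (\<lambda>(\<omega>, s). H s \<omega> * J \<omega>)"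
  proof (rule integrableI_bounded)
    have "(\<integral>\<^sup>+x. ennreal (norm (case x of (\<omega>, s) \<Rightarrow> H s \<omega> * J \<omega>)) \<partial>(M \<Otimes>\<^sub>M lborel))
      = (\<integral>\<^sup>+s. (\<integral>\<^sup>+\<omega>. ennreal \<bar>H s \<omega> * J \<omega>\<bar> \<partial>M) \<partial>lborel)"
      by (subst nn_integral_snd[symmetric]) auto
    also have "\<dots> \<le> (\<integral>\<^sup>+s. (\<integral>\<^sup>+\<omega>. (\<integral>\<^sup>+r. ennreal \<bar>H s \<omega> * H r \<omega>\<bar> \<partial>lborel) \<partial>M) \<partial>lborel)"
    proof (intro nn_integral_mono)
      fix s \<omega>
      have "ennreal \<bar>H s \<omega> * J \<omega>\<bar> = ennreal (norm (LINT r|lborel. H s \<omega> * H r \<omega>))"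
        by (simp add: J_def)
      also have "\<dots> \<le> (\<integral>\<^sup>+r. ennreal (norm (H s \<omega> * H r \<omega>)) \<partial>lborel)"
        by (intro integral_norm_bound_ennreal) (simp add: int)
      finally show "ennreal \<bar>H s \<omega> * J \<omega>\<bar> \<le> (\<integral>\<^sup>+r. ennreal \<bar>H s \<omega> * H r \<omega>\<bar> \<partial>lborel)" by simp
    qed
    also have "\<dots> = (\<integral>\<^sup>+s. (\<integral>\<^sup>+r. (\<integral>\<^sup>+\<omega>. ennreal \<bar>H s \<omega> * H r \<omega>\<bar> \<partial>M) \<partial>lborel) \<partial>lborel)"
      by (subst Fubini') auto
    also have "\<dots> \<le> (\<integral>\<^sup>+s. (\<integral>\<^sup>+r. ennreal C * indicator {0..t} s * indicator {0..t} r \<partial>lborel) \<partial>lborel)"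
      by (intro nn_integral_mono HH)
    also have "\<dots> = ennreal C * ennreal t * ennreal t"
      by (simp add: nn_integral_cmult ind nn_integral_multc)
    finally show "(\<integral>\<^sup>+x. ennreal (norm (case x of (\<omega>, s) \<Rightarrow> H s \<omega> * J \<omega>)) \<partial>(M \<Otimes>\<^sub>M lborel)) < \<infinity>"
      using fin(2) by (rule le_less_trans)
  qed measurable
  \<comment> \<open>Only one factor of the square is opened at a time, with \<open>J\<close> held as
    a random variable; Fubini is then needed on \<open>M\<close> times the line, never on a triple
    product.\<close>
  have sq: "(LINT s|lborel. H s \<omega>)\<^sup>2 = (LINT s|lborel. H s \<omega> * J \<omega>)" for \<omega>
    by (simp add: power2_eq_square J_def)
  show "integrable M (\<lambda>\<omega>. (LINT s|lborel. H s \<omega>)\<^sup>2)"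
    unfolding sq using integrable_fst[OF f] by simp
  have "expectation (\<lambda>\<omega>. (LINT s|lborel. H s \<omega>)\<^sup>2) = (LINT s|lborel. expectation (\<lambda>\<omega>. H s \<omega> * J \<omega>))"
    unfolding sq using Fubini_integral[OF f] by simp
  also have "\<dots> = (LINT s|lborel. LINT r|lborel. expectation (\<lambda>\<omega>. H s \<omega> * H r \<omega>))"
    using Fubini_integral[OF g] by (simp add: J_def)
  finally show "expectation (\<lambda>\<omega>. (LINT s|lborel. H s \<omega>)\<^sup>2) =
      (LINT s|lborel. LINT r|lborel. expectation (\<lambda>\<omega>. H s \<omega> * H r \<omega>))" .
qed

section \<open>Moments and correlations of squared Brownian increments\<close>

lemma brownian_increment_moments:
  assumes bm: "brownian_motion P T B" and st: "0 \<le> s" "s \<le> t" "t \<le> T"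
  shows "integrable P (\<lambda>\<omega>. (B t \<omega> - B s \<omega>) ^ 2)" "integrable P (\<lambda>\<omega>. (B t \<omega> - B s \<omega>) ^ 4)"
    and "prob_space.expectation P (\<lambda>\<omega>. (B t \<omega> - B s \<omega>) ^ 2) = t - s"
    and "prob_space.expectation P (\<lambda>\<omega>. (B t \<omega> - B s \<omega>) ^ 4) = 3 * (t - s)\<^sup>2"
proof -
  interpret prob_space P using bm by (simp add: brownian_motion_def)
  \<comment> \<open>The constant is the double factorial of \<open>2 * k - 1\<close>: 1 for the
    second moment and 3 for the fourth.\<close>
  have "has_bochner_integral P (\<lambda>\<omega>. (B t \<omega> - B s \<omega>) ^ (2 * k)) (fact (2 * k) / (2 ^ k * fact k) * (t - s) ^ k)" if "k > 0" for k
  proof (cases "s = t")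
    \<comment> \<open>An increment over an empty interval is zero and has no density, so it is
      outside the Gaussian clause of \<open>brownian_motion\<close>.\<close>
    case True
    then show ?thesis using that by (simp add: zero_power has_bochner_integral_zero)
  next
    case False
    then have "distributed P lborel (\<lambda>\<omega>. B t \<omega> - B s \<omega>) (normal_density 0 (sqrt (t - s)))" and lt: "s < t"
      using bm st by (auto simp: brownian_motion_def)
    note d = this(1)
    have "has_bochner_integral lborel (\<lambda>x. normal_density 0 (sqrt (t - s)) x * x ^ (2 * k))
       (fact (2 * k) / (2 ^ k * fact k) * (t - s) ^ k)"
      using normal_moment_even[of "sqrt (t - s)" 0 k] lt by (simp add: power_divide)
    then show ?thesis
      unfolding has_bochner_integral_iff
      using distributed_integrable[OF d, of "\<lambda>x. x ^ (2 * k)"] distributed_integral[OF d, of "\<lambda>x. x ^ (2 * k)"]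
      by simp
  qed
  from this[of 1] this[of 2] show "integrable P (\<lambda>\<omega>. (B t \<omega> - B s \<omega>) ^ 2)" "integrable P (\<lambda>\<omega>. (B t \<omega> - B s \<omega>) ^ 4)"
    "prob_space.expectation P (\<lambda>\<omega>. (B t \<omega> - B s \<omega>) ^ 2) = t - s"
    "prob_space.expectation P (\<lambda>\<omega>. (B t \<omega> - B s \<omega>) ^ 4) = 3 * (t - s)\<^sup>2"
    by (auto simp: has_bochner_integral_iff fact_numeral)
qed

text \<open>Centring at \<open>h\<close> while the interval may be shorter allows for increments cut
  off at the horizon. The 4 is 3 from the fourth moment plus 1 from \<open>h\<^sup>2\<close>, the
  negative mixed term being dropped.\<close>

lemma brownian_squared_increment_second_moment:
  assumes bm: "brownian_motion P T B" and st: "0 \<le> s" "s \<le> t" "t \<le> T" "t - s \<le> h"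
  shows "integrable P (\<lambda>\<omega>. ((B t \<omega> - B s \<omega>)\<^sup>2 - h)\<^sup>2)"
    and "prob_space.expectation P (\<lambda>\<omega>. ((B t \<omega> - B s \<omega>)\<^sup>2 - h)\<^sup>2) \<le> 4 * h\<^sup>2"
proof -
  interpret prob_space P using bm by (simp add: brownian_motion_def)
  note m = brownian_increment_moments[OF bm st(1-3)]
  have eq: "((B t \<omega> - B s \<omega>)\<^sup>2 - h)\<^sup>2 = (B t \<omega> - B s \<omega>) ^ 4 - 2 * h * (B t \<omega> - B s \<omega>)\<^sup>2 + h\<^sup>2" for \<omega>
    by (simp add: power2_eq_square power4_eq_xxxx algebra_simps)
  show "integrable P (\<lambda>\<omega>. ((B t \<omega> - B s \<omega>)\<^sup>2 - h)\<^sup>2)" unfolding eq using m by auto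
  have "expectation (\<lambda>\<omega>. ((B t \<omega> - B s \<omega>)\<^sup>2 - h)\<^sup>2) = 3 * (t - s)\<^sup>2 - 2 * h * (t - s) + h\<^sup>2"
    unfolding eq using m by (simp add: prob_space)
  also have "\<dots> \<le> 3 * h\<^sup>2 - 0 + h\<^sup>2"
    using st by (intro add_mono diff_mono mult_left_mono power_mono mult_nonneg_nonneg) auto
  finally show "expectation (\<lambda>\<omega>. ((B t \<omega> - B s \<omega>)\<^sup>2 - h)\<^sup>2) \<le> 4 * h\<^sup>2" by simp
qed

text \<open>The two factors are independent and the earlier one, over a full step \<open>h\<close>,
  has mean zero. That is enough for the product, even when the later increment is cut off at
  \<open>T\<close> and its factor is not centred.\<close>

lemma brownian_squared_increments_uncorrelated:
  assumes bm: "brownian_motion P T B" and st: "0 \<le> s" "0 \<le> h" "s + h \<le> r" "r \<le> v" "v \<le> T"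
  shows "prob_space.expectation P (\<lambda>\<omega>. ((B (s + h) \<omega> - B s \<omega>)\<^sup>2 - h) * ((B v \<omega> - B r \<omega>)\<^sup>2 - h)) = 0"
proof -
  interpret prob_space P using bm by (simp add: brownian_motion_def)
  \<comment> \<open>Four times give three consecutive increments; the middle one, over the gap from
    \<open>s + h\<close> to \<open>r\<close>, is discarded by restricting to the indices 0 and
    2.\<close>
  define \<tau> where "\<tau> i = [s, s + h, r, v] ! i" for i
  define X where "X i \<omega> = B (\<tau> (Suc i)) \<omega> - B (\<tau> i) \<omega>" for i \<omega>
  have "(\<forall>i\<le>3. \<tau> i \<in> {0..T}) \<and> (\<forall>i<3. \<tau> i \<le> \<tau> (Suc i))"
    using st by (auto simp: \<tau>_def numeral_3_eq_3 le_Suc_eq less_Suc_eq)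
  then have "indep_vars (\<lambda>_. borel) X {..<3}"
    using bm unfolding brownian_motion_def X_def by blast
  then have "indep_vars (\<lambda>_. borel) X {0, 2}" by (rule indep_vars_subset) auto
  then have ind: "indep_vars (\<lambda>_. borel) (\<lambda>i \<omega>. (X i \<omega>)\<^sup>2 - h) {0, 2}"
    by (rule indep_vars_compose2) auto
  have X: "X 0 = (\<lambda>\<omega>. B (s + h) \<omega> - B s \<omega>)" "X 2 = (\<lambda>\<omega>. B v \<omega> - B r \<omega>)"
    by (auto simp: X_def \<tau>_def numeral_2_eq_2)
  note m1 = brownian_increment_moments[OF bm, of s "s + h"]
  note m2 = brownian_increment_moments[OF bm, of r v]
  have "expectation (\<lambda>\<omega>. \<Prod>i\<in>{0, 2}. (X i \<omega>)\<^sup>2 - h) = (\<Prod>i\<in>{0, 2}. expectation (\<lambda>\<omega>. (X i \<omega>)\<^sup>2 - h))"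
    using m1 m2 st by (intro indep_vars_lebesgue_integral ind) (auto simp: X)
  moreover have "expectation (\<lambda>\<omega>. (X 0 \<omega>)\<^sup>2 - h) = 0"
    using m1 st by (simp add: X prob_space)
  ultimately show ?thesis by (simp add: X)
qed

lemma set_lebesgue_integral_continuous:
  fixes f :: "real \<Rightarrow> real"
  assumes "continuous_on UNIV f"
  shows "(LINT s:{a..b}|lborel. f s) = integral {a..b} f"
  using assms
  by (intro set_borel_integral_eq_integral borel_integrable_atLeastAtMost') (auto intro: continuous_on_subset)

text \<open>
  On the null set of discontinuous paths \<open>B\<close> is replaced, which yields joint measurability
  in \<open>(\<omega>, t)\<close>; constancy after \<open>T\<close> matches \<^const>\<open>stopped_at\<close>.
\<close>
locale continuous_version =
  fixes P :: "'a measure" and T :: real and B b :: "real \<Rightarrow> 'a \<Rightarrow> real"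
  assumes bm: "brownian_motion P T B" and T_pos: "T > 0"
    and b_meas[measurable]: "\<And>t. b t \<in> borel_measurable P"
    and b_cont: "\<And>\<omega>. continuous_on UNIV (\<lambda>t. b t \<omega>)"
    and b_const: "\<And>t \<omega>. T \<le> t \<Longrightarrow> b t \<omega> = b T \<omega>"
    and b_eq: "AE \<omega> in P. \<forall>t\<in>{0..T}. b t \<omega> = B t \<omega>"

lemma exists_continuous_version:
  assumes bm: "brownian_motion P T B" and T: "T > 0"
  obtains b where "continuous_version P T B b"
proof -
  have "AE \<omega> in P. continuous_on {0..T} (\<lambda>t. B t \<omega>)" using bm by (simp add: brownian_motion_def)
  then obtain N where N: "{\<omega> \<in> space P. \<not> continuous_on {0..T} (\<lambda>t. B t \<omega>)} \<subseteq> N"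
    "emeasure P N = 0" "N \<in> sets P" by (rule AE_E)
  \<comment> \<open>\<open>N\<close> is a measurable null set containing the discontinuous paths,
    which need not form a measurable set themselves. Clamping the time to \<open>{0..T}\<close>
    gives continuity and measurability on the whole line.\<close>
  define b where "b t \<omega> = (if \<omega> \<in> space P - N then B (max 0 (min t T)) \<omega> else 0)" for t \<omega>
  have "continuous_version P T B b"
  proof
    fix t
    have "B (max 0 (min t T)) \<in> borel_measurable P"
      using bm T by (auto simp: brownian_motion_def process_on_def)
    then show "b t \<in> borel_measurable P"
      unfolding b_def using N(3) by (intro measurable_If_set) auto
  next
    fix \<omega>
    show "continuous_on UNIV (\<lambda>t. b t \<omega>)"
    proof (cases "\<omega> \<in> space P - N")
      case True
      then have "continuous_on {0..T} (\<lambda>t. B t \<omega>)" using N(1) by auto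
      then have "continuous_on UNIV (\<lambda>t. B (max 0 (min t T)) \<omega>)"
        by (rule continuous_on_compose2) (use T in \<open>auto intro!: continuous_intros\<close>)
      then show ?thesis using True by (simp add: b_def)
    next
      case False
      then have "b t \<omega> = 0" for t by (auto simp: b_def)
      then show ?thesis by simp
    qed
  next
    fix t \<omega> assume "T \<le> t"
    then show "b t \<omega> = b T \<omega>" by (simp add: b_def)
  next
    have "AE \<omega> in P. \<omega> \<notin> N" using N by (intro AE_not_in) auto
    then show "AE \<omega> in P. \<forall>t\<in>{0..T}. b t \<omega> = B t \<omega>"
      by (rule AE_mp) (auto simp: b_def intro!: AE_I2)
  qed (fact bm T)+
  then show ?thesis by (rule that)
qed

context continuous_version
begin

sublocale prob_space P using bm by (simp add: brownian_motion_def)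

lemma b_measurable_compose[measurable (raw)]:
  assumes [measurable]: "f \<in> measurable N P" "g \<in> borel_measurable N"
  shows "(\<lambda>x. b (g x) (f x)) \<in> borel_measurable N"
proof -
  have m: "(\<lambda>(\<omega>, t). b t \<omega>) \<in> borel_measurable (P \<Otimes>\<^sub>M borel)"
    by (rule borel_measurable_continuous_process[OF b_meas b_cont])
  have "(\<lambda>x. (\<lambda>(\<omega>, t). b t \<omega>) (f x, g x)) \<in> borel_measurable N"
    by (rule measurable_compose[OF _ m]) measurable
  then show ?thesis by simp
qed

lemma b_continuous[continuous_intros]:
  "continuous_on A g \<Longrightarrow> continuous_on A (\<lambda>s. b (g s) \<omega>)"
  by (rule continuous_on_compose2[OF b_cont]) auto

lemma b_increment_AE:
  assumes "s \<in> {0..T}" "h \<ge> 0"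
  shows "AE \<omega> in P. b (s + h) \<omega> - b s \<omega> = B (min (s + h) T) \<omega> - B s \<omega>"
  using b_eq
proof eventually_elim
  case (elim \<omega>)
  have "b (s + h) \<omega> = b (min (s + h) T) \<omega>" using b_const[of "s + h" \<omega>] by (cases "s + h \<le> T") auto
  then show ?case using elim assms T_pos by auto
qed

section \<open>Regularised quadratic variation\<close>

lemma squared_increment_second_moment:
  assumes "s \<in> {0..T}" "h \<ge> 0"
  shows "integrable P (\<lambda>\<omega>. ((b (s + h) \<omega> - b s \<omega>)\<^sup>2 - h)\<^sup>2)"
    and "expectation (\<lambda>\<omega>. ((b (s + h) \<omega> - b s \<omega>)\<^sup>2 - h)\<^sup>2) \<le> 4 * h\<^sup>2"
proof -
  note m = brownian_squared_increment_second_moment[OF bm, of s "min (s + h) T" h]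
  have [measurable]: "B s \<in> borel_measurable P" "B (min (s + h) T) \<in> borel_measurable P"
    using bm assms by (auto simp: brownian_motion_def process_on_def)
  have ae: "AE \<omega> in P. ((b (s + h) \<omega> - b s \<omega>)\<^sup>2 - h)\<^sup>2 = ((B (min (s + h) T) \<omega> - B s \<omega>)\<^sup>2 - h)\<^sup>2"
    using b_increment_AE[OF assms] by eventually_elim simp
  have "integrable P (\<lambda>\<omega>. ((b (s + h) \<omega> - b s \<omega>)\<^sup>2 - h)\<^sup>2) \<longleftrightarrow>
    integrable P (\<lambda>\<omega>. ((B (min (s + h) T) \<omega> - B s \<omega>)\<^sup>2 - h)\<^sup>2)"
    using ae by (intro integrable_cong_AE) auto
  then show "integrable P (\<lambda>\<omega>. ((b (s + h) \<omega> - b s \<omega>)\<^sup>2 - h)\<^sup>2)" using m assms by auto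
  have "expectation (\<lambda>\<omega>. ((b (s + h) \<omega> - b s \<omega>)\<^sup>2 - h)\<^sup>2) =
    expectation (\<lambda>\<omega>. ((B (min (s + h) T) \<omega> - B s \<omega>)\<^sup>2 - h)\<^sup>2)"
    using ae by (intro integral_cong_AE) auto
  then show "expectation (\<lambda>\<omega>. ((b (s + h) \<omega> - b s \<omega>)\<^sup>2 - h)\<^sup>2) \<le> 4 * h\<^sup>2" using m assms by auto
qed

lemma squared_increments_uncorrelated:
  assumes "0 \<le> s" "s + h \<le> r" "r \<le> T" "h \<ge> 0"
  shows "expectation (\<lambda>\<omega>. ((b (s + h) \<omega> - b s \<omega>)\<^sup>2 - h) * ((b (r + h) \<omega> - b r \<omega>)\<^sup>2 - h)) = 0"
proof -
  have [measurable]: "B s \<in> borel_measurable P" "B (s + h) \<in> borel_measurable P"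
    "B r \<in> borel_measurable P" "B (min (r + h) T) \<in> borel_measurable P"
    using bm assms by (auto simp: brownian_motion_def process_on_def)
  have "AE \<omega> in P. b (s + h) \<omega> - b s \<omega> = B (s + h) \<omega> - B s \<omega>"
    using b_increment_AE[of s h] assms by (simp add: min_def)
  moreover have "AE \<omega> in P. b (r + h) \<omega> - b r \<omega> = B (min (r + h) T) \<omega> - B r \<omega>"
    using b_increment_AE[of r h] assms by simp
  ultimately have "AE \<omega> in P. ((b (s + h) \<omega> - b s \<omega>)\<^sup>2 - h) * ((b (r + h) \<omega> - b r \<omega>)\<^sup>2 - h) =
     ((B (s + h) \<omega> - B s \<omega>)\<^sup>2 - h) * ((B (min (r + h) T) \<omega> - B r \<omega>)\<^sup>2 - h)"
    by eventually_elim simp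
  then have "expectation (\<lambda>\<omega>. ((b (s + h) \<omega> - b s \<omega>)\<^sup>2 - h) * ((b (r + h) \<omega> - b r \<omega>)\<^sup>2 - h)) =
     expectation (\<lambda>\<omega>. ((B (s + h) \<omega> - B s \<omega>)\<^sup>2 - h) * ((B (min (r + h) T) \<omega> - B r \<omega>)\<^sup>2 - h))"
    by (intro integral_cong_AE) auto
  also have "\<dots> = 0"
    using assms by (intro brownian_squared_increments_uncorrelated[OF bm]) auto
  finally show ?thesis .
qed

text \<open>The covariance of the centred squared increments at \<open>s\<close> and
  \<open>r\<close> vanishes unless the two windows overlap, and is otherwise at most
  \<open>4 * h\<^sup>2\<close>. The strip of overlapping pairs has width \<open>2 * h\<close>,
  whence \<open>8 * T * h ^ 3\<close>; dividing the integral by \<open>h\<close> leaves a second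
  moment of order \<open>h\<close>.\<close>

lemma quadratic_variation_second_moment:
  assumes h: "h > 0" and t: "t \<in> {0..T}"
  shows "integrable P (\<lambda>\<omega>. (LINT s:{0..t}|lborel. (b (s + h) \<omega> - b s \<omega>)\<^sup>2 - h)\<^sup>2)"
    and "expectation (\<lambda>\<omega>. (LINT s:{0..t}|lborel. (b (s + h) \<omega> - b s \<omega>)\<^sup>2 - h)\<^sup>2) \<le> 8 * T * h ^ 3"
proof -
  define D where "D s \<omega> = (b (s + h) \<omega> - b s \<omega>)\<^sup>2 - h" for s \<omega>
  define H where "H s \<omega> = indicator {0..t} s *\<^sub>R D s \<omega>" for s \<omega>
  have Hm: "(\<lambda>(\<omega>, s). H s \<omega>) \<in> borel_measurable (P \<Otimes>\<^sub>M lborel)"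
    unfolding H_def D_def split_beta by measurable
  have Dm[measurable]: "D s \<in> borel_measurable P" for s unfolding D_def by measurable
  have int: "integrable lborel (\<lambda>s. H s \<omega>)" for \<omega>
    unfolding H_def D_def
    by (intro borel_integrable_atLeastAtMost'[unfolded set_integrable_def] continuous_intros)
  have D2: "integrable P (\<lambda>\<omega>. (D s \<omega>)\<^sup>2)" "expectation (\<lambda>\<omega>. (D s \<omega>)\<^sup>2) \<le> 4 * h\<^sup>2" if "s \<in> {0..t}" for s
    unfolding D_def using that t h squared_increment_second_moment[of s h] by auto
  have bd: "(\<integral>\<^sup>+\<omega>. (H s \<omega>)\<^sup>2 \<partial>P) \<le> ennreal (4 * h\<^sup>2)" if "s \<in> {0..t}" for s
    using D2[OF that] that by (simp add: H_def nn_integral_eq_integral)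
  note sm = second_moment_integral[of H t "4 * h\<^sup>2", OF Hm int _ bd]
  have J: "(LINT s:{0..t}|lborel. (b (s + h) \<omega> - b s \<omega>)\<^sup>2 - h) = (LINT s|lborel. H s \<omega>)" for \<omega>
    by (simp add: H_def D_def set_lebesgue_integral_def)
  show "integrable P (\<lambda>\<omega>. (LINT s:{0..t}|lborel. (b (s + h) \<omega> - b s \<omega>)\<^sup>2 - h)\<^sup>2)"
    unfolding J using t by (intro sm) (auto simp: H_def)
  have EHH: "expectation (\<lambda>\<omega>. H s \<omega> * H r \<omega>) \<le> 4 * h\<^sup>2 * (indicator {0..t} s * indicator {s - h..s + h} r)" for s r
  proof (cases "s \<in> {0..t} \<and> r \<in> {0..t}")
    case in01: True
    show ?thesis
    proof (cases "r \<in> {s - h..s + h}")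
      case True
      have "expectation (\<lambda>\<omega>. D s \<omega> * D r \<omega>) \<le> expectation (\<lambda>\<omega>. (1 / 2) * ((D s \<omega>)\<^sup>2 + (D r \<omega>)\<^sup>2))"
      proof (rule integral_mono')
        show "integrable P (\<lambda>\<omega>. (1 / 2) * ((D s \<omega>)\<^sup>2 + (D r \<omega>)\<^sup>2))" using D2 in01 by auto
        show "D s \<omega> * D r \<omega> \<le> (1 / 2) * ((D s \<omega>)\<^sup>2 + (D r \<omega>)\<^sup>2)" for \<omega>
          using sum_squares_bound[of "D s \<omega>" "D r \<omega>"] by simp
      qed auto
      also have "\<dots> \<le> 4 * h\<^sup>2" using D2[of s] D2[of r] in01 by simp
      finally show ?thesis using in01 True by (simp add: H_def)
    next
      case False
      then consider "s + h \<le> r" | "r + h \<le> s" by fastforce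
      then have "expectation (\<lambda>\<omega>. D s \<omega> * D r \<omega>) = 0"
      proof cases
        case 1
        then show ?thesis unfolding D_def using in01 t h by (intro squared_increments_uncorrelated) auto
      next
        case 2
        then have "expectation (\<lambda>\<omega>. D r \<omega> * D s \<omega>) = 0"
          unfolding D_def using in01 t h by (intro squared_increments_uncorrelated) auto
        then show ?thesis by (simp add: mult.commute)
      qed
      then show ?thesis using in01 False by (simp add: H_def)
    qed
  qed (auto simp: H_def)
  have "expectation (\<lambda>\<omega>. (LINT s|lborel. H s \<omega>)\<^sup>2) = (LINT s|lborel. LINT r|lborel. expectation (\<lambda>\<omega>. H s \<omega> * H r \<omega>))"
    using t by (intro sm) (auto simp: H_def)
  also have "\<dots> \<le> (LINT s|lborel. indicator {0..t} s * (8 * h ^ 3))"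
  proof (rule integral_mono')
    fix s
    have "(LINT r|lborel. expectation (\<lambda>\<omega>. H s \<omega> * H r \<omega>)) \<le>
      (LINT r|lborel. 4 * h\<^sup>2 * (indicator {0..t} s * indicator {s - h..s + h} r))"
      using h by (intro integral_mono' EHH) auto
    also have "\<dots> = indicator {0..t} s * (8 * h ^ 3)"
      using h by (simp add: power3_eq_cube power2_eq_square)
    finally show "(LINT r|lborel. expectation (\<lambda>\<omega>. H s \<omega> * H r \<omega>)) \<le> indicator {0..t} s * (8 * h ^ 3)" .
  qed (use h t in \<open>auto intro!: integrable_real_indicator\<close>)
  also have "\<dots> = t * (8 * h ^ 3)" using t by simp
  also have "\<dots> \<le> T * (8 * h ^ 3)" using t h by (intro mult_right_mono) auto
  finally show "expectation (\<lambda>\<omega>. (LINT s:{0..t}|lborel. (b (s + h) \<omega> - b s \<omega>)\<^sup>2 - h)\<^sup>2) \<le> 8 * T * h ^ 3"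
    unfolding J by simp
qed

text \<open>The second moments of \<open>J n / h n\<close> are summable because \<open>h\<close> is.
  So the series of squares has finite expectation, is finite almost surely, and its terms tend to
  zero; this takes the place of Chebyshev and Borel-Cantelli.\<close>

lemma quadratic_variation_AE:
  assumes h: "\<And>n. h n > 0" "summable h" and t: "t \<in> {0..T}"
  shows "AE \<omega> in P. (\<lambda>n. integral {0..t} (\<lambda>s. (b (s + h n) \<omega> - b s \<omega>)\<^sup>2 / h n)) \<longlonglongrightarrow> t"
proof -
  define J where "J n \<omega> = (LINT s:{0..t}|lborel. (b (s + h n) \<omega> - b s \<omega>)\<^sup>2 - h n)" for n \<omega>
  have [measurable]: "J n \<in> borel_measurable P" for n
    unfolding J_def set_lebesgue_integral_def by measurable
  have J2: "integrable P (\<lambda>\<omega>. (J n \<omega>)\<^sup>2)" "expectation (\<lambda>\<omega>. (J n \<omega>)\<^sup>2) \<le> 8 * T * h n ^ 3" for n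
    unfolding J_def by (rule quadratic_variation_second_moment[OF h(1) t])+
  have bound: "(\<integral>\<^sup>+\<omega>. ennreal ((J n \<omega> / h n)\<^sup>2) \<partial>P) \<le> ennreal (8 * T * h n)" for n
  proof -
    have "(\<integral>\<^sup>+\<omega>. ennreal ((J n \<omega> / h n)\<^sup>2) \<partial>P) = ennreal (expectation (\<lambda>\<omega>. (J n \<omega> / h n)\<^sup>2))"
      using J2(1)[of n] by (intro nn_integral_eq_integral) (auto simp: power_divide)
    also have "expectation (\<lambda>\<omega>. (J n \<omega> / h n)\<^sup>2) = expectation (\<lambda>\<omega>. (J n \<omega>)\<^sup>2) / (h n)\<^sup>2"
      by (simp add: power_divide)
    also have "\<dots> \<le> 8 * T * h n ^ 3 / (h n)\<^sup>2" using J2(2)[of n] by (intro divide_right_mono) auto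
    also have "\<dots> = 8 * T * h n" using h(1)[of n] by (simp add: power2_eq_square power3_eq_cube)
    finally show ?thesis by (simp add: ennreal_leI)
  qed
  have "(\<integral>\<^sup>+\<omega>. (\<Sum>n. ennreal ((J n \<omega> / h n)\<^sup>2)) \<partial>P) = (\<Sum>n. \<integral>\<^sup>+\<omega>. ennreal ((J n \<omega> / h n)\<^sup>2) \<partial>P)"
    by (intro nn_integral_suminf) auto
  also have "\<dots> \<le> (\<Sum>n. ennreal (8 * T * h n))" by (intro suminf_le bound) auto
  also have "\<dots> = ennreal (\<Sum>n. 8 * T * h n)"
    using h T_pos by (intro suminf_ennreal2 summable_mult) (auto intro!: mult_nonneg_nonneg less_imp_le)
  also have "\<dots> < \<infinity>" by simp
  finally have "AE \<omega> in P. (\<Sum>n. ennreal ((J n \<omega> / h n)\<^sup>2)) \<noteq> \<infinity>"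
    by (intro nn_integral_noteq_infinite) auto
  then show ?thesis
  proof eventually_elim
    case (elim \<omega>)
    have "summable (\<lambda>n. (J n \<omega> / h n)\<^sup>2)"
      using elim by (intro summable_suminf_not_top) auto
    then have "(\<lambda>n. (J n \<omega> / h n)\<^sup>2) \<longlonglongrightarrow> 0" by (rule summable_LIMSEQ_zero)
    then have "(\<lambda>n. sqrt ((J n \<omega> / h n)\<^sup>2)) \<longlonglongrightarrow> sqrt 0" by (rule tendsto_real_sqrt)
    then have "(\<lambda>n. J n \<omega> / h n) \<longlonglongrightarrow> 0"
      unfolding real_sqrt_abs real_sqrt_zero by (rule tendsto_rabs_zero_cancel)
    then have "(\<lambda>n. J n \<omega> / h n + t) \<longlonglongrightarrow> 0 + t" by (intro tendsto_intros)
    moreover have "J n \<omega> / h n + t = integral {0..t} (\<lambda>s. (b (s + h n) \<omega> - b s \<omega>)\<^sup>2 / h n)" for n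
    proof -
      have "J n \<omega> = integral {0..t} (\<lambda>s. (b (s + h n) \<omega> - b s \<omega>)\<^sup>2 - h n)"
        unfolding J_def by (intro set_lebesgue_integral_continuous continuous_intros)
      also have "\<dots> = integral {0..t} (\<lambda>s. (b (s + h n) \<omega> - b s \<omega>)\<^sup>2) - integral {0..t} (\<lambda>s. h n)"
        by (intro integral_diff integrable_continuous_on_UNIV continuous_intros)
      finally show ?thesis using t h(1)[of n] by (simp add: diff_divide_distrib)
    qed
    ultimately show ?case by (simp only: add_0)
  qed
qed

section \<open>The forward equation\<close>

text \<open>
  Path continuity reduces the exceptional sets to countably many \<open>t\<close>, which makes them measurable
  even though \<open>P\<close> is not assumed complete.
\<close>
lemma forward_integral_exp_in_probability:
  fixes \<mu> \<sigma> :: real and \<xi> :: "'a \<Rightarrow> real"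
  defines "X \<equiv> (\<lambda>t \<omega>. \<xi> \<omega> * exp (\<sigma> * b t \<omega> + (\<mu> - \<sigma>\<^sup>2 / 2) * t))"
  defines "G \<equiv> (\<lambda>\<epsilon> t \<omega>. (LINT s:{0..t}|lborel. X s \<omega> * ((b (s + \<epsilon>) \<omega> - b s \<omega>) / \<epsilon>)) -
      (X t \<omega> - X 0 \<omega> - \<mu> * (LINT s:{0..t}|lborel. X s \<omega>)) / \<sigma>)"
  defines "A \<equiv> (\<lambda>\<delta> \<epsilon>. {\<omega> \<in> space P. \<exists>t\<in>{0..T}. \<delta> < \<bar>G \<epsilon> t \<omega>\<bar>})"
  assumes \<sigma>: "\<sigma> > 0" and \<xi>[measurable]: "\<xi> \<in> borel_measurable P"
  shows "\<And>\<delta> \<epsilon>. \<epsilon> > 0 \<Longrightarrow> A \<delta> \<epsilon> \<in> sets P"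
    and "\<And>\<delta>. \<delta> > 0 \<Longrightarrow> ((\<lambda>\<epsilon>. prob (A \<delta> \<epsilon>)) \<longlongrightarrow> 0) (at_right 0)"
proof -
  have cX: "continuous_on UNIV (\<lambda>t. X t \<omega>)" for \<omega> unfolding X_def by (intro continuous_intros)
  have cXi: "continuous_on UNIV (\<lambda>s. X s \<omega> * ((b (s + \<epsilon>) \<omega> - b s \<omega>) / \<epsilon>))" if "\<epsilon> > 0" for \<epsilon> \<omega>
    using that by (intro continuous_intros cX) auto
  have G_HK: "G \<epsilon> t \<omega> = integral {0..t} (\<lambda>s. X s \<omega> * ((b (s + \<epsilon>) \<omega> - b s \<omega>) / \<epsilon>)) -
      (X t \<omega> - X 0 \<omega> - \<mu> * integral {0..t} (\<lambda>s. X s \<omega>)) / \<sigma>" if "\<epsilon> > 0" for \<epsilon> t \<omega>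
    unfolding G_def by (simp only: set_lebesgue_integral_continuous[OF cX] set_lebesgue_integral_continuous[OF cXi[OF that]])
  have cG: "continuous_on {0..T} (\<lambda>t. G \<epsilon> t \<omega>)" if "\<epsilon> > 0" for \<epsilon> \<omega>
    unfolding G_HK[OF that] using \<sigma>
    by (intro continuous_intros indefinite_integral_continuous_1 integrable_continuous_on_UNIV
        continuous_on_subset[OF cX] cX cXi that) auto
  have mG[measurable]: "G \<epsilon> t \<in> borel_measurable P" for \<epsilon> t
    unfolding G_def X_def set_lebesgue_integral_def by measurable
  obtain D :: "real set" where D: "countable D" "D \<subseteq> {0..T}" "{0..T} \<subseteq> closure D"
    by (rule separable)
  show A_sets: "A \<delta> \<epsilon> \<in> sets P" if \<epsilon>: "\<epsilon> > 0" for \<delta> \<epsilon>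
  proof -
    have "A \<delta> \<epsilon> = (\<Union>t\<in>D. {\<omega> \<in> space P. \<delta> < \<bar>G \<epsilon> t \<omega>\<bar>})"
    proof
      show "(\<Union>t\<in>D. {\<omega> \<in> space P. \<delta> < \<bar>G \<epsilon> t \<omega>\<bar>}) \<subseteq> A \<delta> \<epsilon>" using D(2) by (auto simp: A_def)
      show "A \<delta> \<epsilon> \<subseteq> (\<Union>t\<in>D. {\<omega> \<in> space P. \<delta> < \<bar>G \<epsilon> t \<omega>\<bar>})"
      proof
        fix \<omega> assume "\<omega> \<in> A \<delta> \<epsilon>"
        then obtain t where t: "\<omega> \<in> space P" "t \<in> {0..T}" "\<delta> < \<bar>G \<epsilon> t \<omega>\<bar>" by (auto simp: A_def)
        \<comment> \<open>The strict inequality defining \<open>A\<close> is an open condition on a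
          continuous function of \<open>t\<close>, so it survives at nearby points of the dense set
          \<open>D\<close>.\<close>
        obtain x where x: "\<And>n :: nat. x n \<in> D" "x \<longlonglongrightarrow> t"
          using D(3) t(2) closure_sequential by blast
        have "(\<lambda>n. \<bar>G \<epsilon> (x n) \<omega>\<bar>) \<longlonglongrightarrow> \<bar>G \<epsilon> t \<omega>\<bar>"
          using x subsetD[OF D(2) x(1)] t
          by (intro tendsto_rabs continuous_on_tendsto_compose[OF cG[OF \<epsilon>]] always_eventually) auto
        then have "\<forall>\<^sub>F n in sequentially. \<delta> < \<bar>G \<epsilon> (x n) \<omega>\<bar>" by (rule order_tendstoD(1)[OF _ t(3)])
        then obtain n where "\<delta> < \<bar>G \<epsilon> (x n) \<omega>\<bar>" by (auto simp: eventually_sequentially)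
        then show "\<omega> \<in> (\<Union>t\<in>D. {\<omega> \<in> space P. \<delta> < \<bar>G \<epsilon> t \<omega>\<bar>})" using x t by auto
      qed
    qed
    also have "\<dots> \<in> sets P" using D(1) by (intro sets.countable_UN') auto
    finally show ?thesis .
  qed
  fix \<delta> :: real assume \<delta>: "\<delta> > 0"
  have seq: "(\<lambda>n. prob (A \<delta> (h n))) \<longlonglongrightarrow> 0" if h: "\<And>n. h n > 0" "summable h" for h
  proof -
    have h0: "h \<longlonglongrightarrow> 0" using h(2) by (rule summable_LIMSEQ_zero)
    have qv: "AE \<omega> in P. k \<le> N \<longrightarrow> N > 0 \<longrightarrow>
        (\<lambda>n. integral {0..T * real k / real N} (\<lambda>s. (b (s + h n) \<omega> - b s \<omega>)\<^sup>2 / h n)) \<longlonglongrightarrow> T * real k / real N" for k N :: nat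
    proof (cases "k \<le> N \<and> N > 0")
      case True
      then have "T * real k / real N \<in> {0..T}"
        using T_pos by (auto simp: pos_divide_le_eq)
      from quadratic_variation_AE[OF h this] show ?thesis by auto
    qed auto
    \<comment> \<open>Countably many grid times mean countably many null sets, hence one exceptional
      set for all of them.\<close>
    have "AE \<omega> in P. \<forall>k N. k \<le> N \<longrightarrow> N > 0 \<longrightarrow>
        (\<lambda>n. integral {0..T * real k / real N} (\<lambda>s. (b (s + h n) \<omega> - b s \<omega>)\<^sup>2 / h n)) \<longlonglongrightarrow> T * real k / real N"
      unfolding AE_all_countable using qv by blast
    then have "AE \<omega> in P. (\<lambda>n. indicat_real (A \<delta> (h n)) \<omega>) \<longlonglongrightarrow> 0"
    proof eventually_elim
      case (elim \<omega>)
      define Y where "Y s = exp (\<sigma> * b s \<omega> + (\<mu> - \<sigma>\<^sup>2 / 2) * s)" for s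
      have qv': "(\<lambda>n. integral {0..T * real k / real N} (\<lambda>s. (b (s + h n) \<omega> - b s \<omega>)\<^sup>2 / h n)) \<longlonglongrightarrow> T * real k / real N"
        if "k \<le> N" "N > 0" for k N
        using elim that by blast
      have "uniform_limit {0..T} (\<lambda>n t. integral {0..t} (\<lambda>s. Y s * ((b (s + h n) \<omega> - b s \<omega>) / h n)))
          (\<lambda>t. (Y t - Y 0 - \<mu> * integral {0..t} Y) / \<sigma>) sequentially"
        unfolding Y_def
        by (rule uniform_limit_forward_integral_exp[OF b_cont[of \<omega>] h0 h(1) T_pos \<sigma> qv'])
      \<comment> \<open>The path is fixed here, so the tolerance may depend on
        \<open>\<omega>\<close> and absorb the factor \<open>\<xi> \<omega>\<close>; the added one
        covers \<open>\<xi> \<omega> = 0\<close>. Each path thus eventually leaves the bad events,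
        and dominated convergence of indicators gives their probabilities.\<close>
      then have "\<forall>\<^sub>F n in sequentially. \<forall>t\<in>{0..T}. dist (integral {0..t} (\<lambda>s. Y s * ((b (s + h n) \<omega> - b s \<omega>) / h n)))
          ((Y t - Y 0 - \<mu> * integral {0..t} Y) / \<sigma>) < \<delta> / (\<bar>\<xi> \<omega>\<bar> + 1)"
        using \<delta> by (intro uniform_limitD) auto
      then have "\<forall>\<^sub>F n in sequentially. indicat_real (A \<delta> (h n)) \<omega> = 0"
      proof eventually_elim
        case (elim n)
        have "\<bar>G (h n) t \<omega>\<bar> \<le> \<delta>" if t: "t \<in> {0..T}" for t
        proof -
          let ?d = "integral {0..t} (\<lambda>s. Y s * ((b (s + h n) \<omega> - b s \<omega>) / h n)) -
            (Y t - Y 0 - \<mu> * integral {0..t} Y) / \<sigma>"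
          have XY: "X s \<omega> = \<xi> \<omega> * Y s" for s by (simp add: X_def Y_def)
          have "G (h n) t \<omega> = \<xi> \<omega> * ?d"
            unfolding G_HK[OF h(1)] XY mult.assoc integral_mult_right
            using \<sigma> by (simp only: right_diff_distrib diff_divide_distrib times_divide_eq_right mult.left_commute[of \<mu> "\<xi> \<omega>"])
          then have "\<bar>G (h n) t \<omega>\<bar> = \<bar>\<xi> \<omega>\<bar> * \<bar>?d\<bar>" by (simp add: abs_mult)
          also have "\<dots> \<le> (\<bar>\<xi> \<omega>\<bar> + 1) * (\<delta> / (\<bar>\<xi> \<omega>\<bar> + 1))"
            using elim t by (intro mult_mono) (auto simp: dist_real_def less_imp_le)
          also have "\<dots> = \<delta>" using abs_ge_zero[of "\<xi> \<omega>"] by (simp add: field_simps)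
          finally show ?thesis .
        qed
        then show ?case by (force simp: A_def indicator_def)
      qed
      then show ?case by (rule tendsto_eventually)
    qed
    then have "(\<lambda>n. expectation (indicat_real (A \<delta> (h n)))) \<longlonglongrightarrow> expectation (\<lambda>_. 0)"
      using A_sets[OF h(1)]
      by (intro integral_dominated_convergence[where w="\<lambda>_. 1"]) (auto simp: indicator_def)
    then show ?thesis using A_sets[OF h(1)] by simp
  qed
  show "((\<lambda>\<epsilon>. prob (A \<delta> \<epsilon>)) \<longlongrightarrow> 0) (at_right 0)"
  proof (rule tendstoI, rule ccontr)
    \<comment> \<open>Bad values of \<open>\<epsilon>\<close> occur arbitrarily close to 0. Choosing
      the n-th below \<open>(1/2) ^ n\<close> makes them summable, which contradicts
      \<open>seq\<close>.\<close>
    fix e :: real assume e: "e > 0" and "\<not> (\<forall>\<^sub>F \<epsilon> in at_right 0. dist (prob (A \<delta> \<epsilon>)) 0 < e)"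
    then have "\<exists>\<epsilon>>0. \<epsilon> < d \<and> e \<le> prob (A \<delta> \<epsilon>)" if "d > 0" for d
      using that by (auto simp: eventually_at_right_field not_less) (metis linorder_not_le)
    then have "\<exists>\<epsilon>>0. \<epsilon> < (1/2) ^ n \<and> e \<le> prob (A \<delta> \<epsilon>)" for n :: nat by simp
    then obtain h where h: "\<And>n :: nat. h n > 0" "\<And>n. h n < (1/2) ^ n" "\<And>n. e \<le> prob (A \<delta> (h n))"
      by metis
    have "summable h"
      using h(1,2) by (intro summable_comparison_test'[OF summable_geometric[of "1/2 :: real"], of 0 h])
        (auto simp: abs_of_pos intro: less_imp_le)
    from seq[OF h(1) this] have "\<forall>\<^sub>F n in sequentially. prob (A \<delta> (h n)) < e"
      by (rule order_tendstoD(2)[OF _ e])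
    with h(3) show False by (auto simp: eventually_sequentially not_less[symmetric])
  qed
qed

text \<open>Transfer from the regular version to the stopped motion: outside a null set
  \<open>N\<close> both have the same increments from any \<open>s\<close> in
  \<open>{0..T}\<close>.\<close>

lemma has_forward_integral_exp:
  fixes \<mu> \<sigma> :: real and \<xi> :: "'a \<Rightarrow> real"
  defines "X \<equiv> (\<lambda>t \<omega>. \<xi> \<omega> * exp (\<sigma> * b t \<omega> + (\<mu> - \<sigma>\<^sup>2 / 2) * t))"
  assumes \<sigma>: "\<sigma> > 0" and \<xi>[measurable]: "\<xi> \<in> borel_measurable P"
  shows "has_forward_integral P (stopped_at T B) 0 T X
    (\<lambda>t \<omega>. (X t \<omega> - X 0 \<omega> - \<mu> * (LINT s:{0..t}|lborel. X s \<omega>)) / \<sigma>)"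
proof -
  have cX: "continuous_on UNIV (\<lambda>t. X t \<omega>)" for \<omega> unfolding X_def by (intro continuous_intros)
  obtain N where N: "{\<omega> \<in> space P. \<not> (\<forall>t\<in>{0..T}. b t \<omega> = B t \<omega>)} \<subseteq> N" "emeasure P N = 0" "N \<in> sets P"
    using b_eq by (rule AE_E)
  have stop: "stopped_at T B (s + \<epsilon>) \<omega> - stopped_at T B s \<omega> = b (s + \<epsilon>) \<omega> - b s \<omega>"
    if "\<omega> \<in> space P - N" "s \<in> {0..T}" "\<epsilon> > 0" for s \<epsilon> \<omega>
  proof -
    have "b (s + \<epsilon>) \<omega> = b (min (s + \<epsilon>) T) \<omega>"
      using b_const[of "s + \<epsilon>" \<omega>] by (cases "s + \<epsilon> \<le> T") auto
    moreover have "\<forall>t\<in>{0..T}. b t \<omega> = B t \<omega>" using N(1) that(1) by auto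
    ultimately show ?thesis using that T_pos by (auto simp: stopped_at_def)
  qed
  have AE_N: "AE \<omega> in P. \<omega> \<in> space P - N" using N by (intro AE_I'[of N]) auto
  show ?thesis
    unfolding has_forward_integral_def
  proof (intro conjI allI impI)
    show "process_on P {0..T} X" unfolding process_on_def X_def by measurable
    show "process_on P {0..T} (\<lambda>t \<omega>. (X t \<omega> - X 0 \<omega> - \<mu> * (LINT s:{0..t}|lborel. X s \<omega>)) / \<sigma>)"
      unfolding process_on_def X_def set_lebesgue_integral_def by measurable
  next
    fix \<epsilon> :: real assume \<epsilon>: "\<epsilon> > 0"
    show "AE \<omega> in P. set_integrable lborel {0..T}
        (\<lambda>s. X s \<omega> * ((stopped_at T B (s + \<epsilon>) \<omega> - stopped_at T B s \<omega>) / \<epsilon>))"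
      using AE_N
    proof eventually_elim
      case (elim \<omega>)
      have "set_integrable lborel {0..T} (\<lambda>s. X s \<omega> * ((b (s + \<epsilon>) \<omega> - b s \<omega>) / \<epsilon>))"
        using \<epsilon> by (intro borel_integrable_atLeastAtMost' continuous_intros continuous_on_subset[OF cX]) auto
      then show ?case using stop[OF elim _ \<epsilon>] by (subst set_integrable_cong) auto
    qed
  next
    fix \<delta> :: real assume \<delta>: "\<delta> > 0"
    define A where "A \<epsilon> = {\<omega> \<in> space P. \<exists>t\<in>{0..T}. \<delta> <
      \<bar>(LINT s:{0..t}|lborel. X s \<omega> * ((b (s + \<epsilon>) \<omega> - b s \<omega>) / \<epsilon>)) -
      (X t \<omega> - X 0 \<omega> - \<mu> * (LINT s:{0..t}|lborel. X s \<omega>)) / \<sigma>\<bar>}" for \<epsilon>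
    have lim1: "A \<epsilon> \<in> sets P" if "\<epsilon> > 0" for \<epsilon>
      unfolding A_def X_def by (rule forward_integral_exp_in_probability(1)[OF \<sigma> \<xi> that])
    have lim2: "((\<lambda>\<epsilon>. prob (A \<epsilon>)) \<longlongrightarrow> 0) (at_right 0)"
      unfolding A_def X_def by (rule forward_integral_exp_in_probability(2)[OF \<sigma> \<xi> \<delta>])
    define F where "F \<epsilon> = outer_measure_of P {\<omega> \<in> space P. ennreal \<delta> <
      (SUP t\<in>{0..T}. ennreal \<bar>(LINT s:{0..t}|lborel. X s \<omega> * ((stopped_at T B (s + \<epsilon>) \<omega> - stopped_at T B s \<omega>) / \<epsilon>)) -
        (X t \<omega> - X 0 \<omega> - \<mu> * (LINT s:{0..t}|lborel. X s \<omega>)) / \<sigma>\<bar>)}" for \<epsilon>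
    have "F \<epsilon> \<le> ennreal (prob (A \<epsilon>))" if \<epsilon>: "\<epsilon> > 0" for \<epsilon>
    proof -
      have A: "A \<epsilon> \<in> sets P" using lim1[OF \<epsilon>] .
      \<comment> \<open>The event involving the supremum need not be measurable, but it lies in the
        measurable set \<open>A \<epsilon> \<union> N\<close>: a supremum strictly above
        \<open>\<delta>\<close> has a witness \<open>t\<close>.\<close>
      have "F \<epsilon> \<le> outer_measure_of P (A \<epsilon> \<union> N)"
        unfolding F_def
      proof (rule outer_measure_of_mono, rule subsetI)
        fix \<omega> assume "\<omega> \<in> {\<omega> \<in> space P. ennreal \<delta> <
          (SUP t\<in>{0..T}. ennreal \<bar>(LINT s:{0..t}|lborel. X s \<omega> * ((stopped_at T B (s + \<epsilon>) \<omega> - stopped_at T B s \<omega>) / \<epsilon>)) -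
          (X t \<omega> - X 0 \<omega> - \<mu> * (LINT s:{0..t}|lborel. X s \<omega>)) / \<sigma>\<bar>)}"
        then obtain t where \<omega>: "\<omega> \<in> space P" and t: "t \<in> {0..T}"
          "\<delta> < \<bar>(LINT s:{0..t}|lborel. X s \<omega> * ((stopped_at T B (s + \<epsilon>) \<omega> - stopped_at T B s \<omega>) / \<epsilon>)) -
          (X t \<omega> - X 0 \<omega> - \<mu> * (LINT s:{0..t}|lborel. X s \<omega>)) / \<sigma>\<bar>"
          using \<delta> by (auto simp: less_SUP_iff ennreal_less_iff)
        show "\<omega> \<in> A \<epsilon> \<union> N"
        proof (cases "\<omega> \<in> N")
          case False
          have "(LINT s:{0..t}|lborel. X s \<omega> * ((stopped_at T B (s + \<epsilon>) \<omega> - stopped_at T B s \<omega>) / \<epsilon>)) =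
            (LINT s:{0..t}|lborel. X s \<omega> * ((b (s + \<epsilon>) \<omega> - b s \<omega>) / \<epsilon>))"
            using stop[of \<omega>] False \<omega> t \<epsilon> by (intro set_lebesgue_integral_cong) auto
          then show ?thesis using t \<omega> by (auto simp: A_def)
        qed auto
      qed
      also have "\<dots> = emeasure P (A \<epsilon> \<union> N)" using A N by (intro outer_measure_of_eq) auto
      also have "\<dots> = emeasure P (A \<epsilon>)" using A N by (intro emeasure_Un_null_set) auto
      finally show ?thesis by (simp add: emeasure_eq_measure)
    qed
    then have "\<forall>\<^sub>F \<epsilon> in at_right 0. F \<epsilon> \<le> ennreal (prob (A \<epsilon>))"
      by (auto simp: eventually_at_filter)
    moreover have "((\<lambda>\<epsilon>. ennreal (prob (A \<epsilon>))) \<longlongrightarrow> 0) (at_right 0)"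
      using tendsto_ennrealI[OF lim2] by simp
    ultimately have "(F \<longlongrightarrow> 0) (at_right 0)"
      using tendsto_sandwich[OF _ _ tendsto_const, of 0 F "at_right 0" "\<lambda>\<epsilon>. ennreal (prob (A \<epsilon>))"] by simp
    then show "((\<lambda>\<epsilon>. outer_measure_of P {\<omega> \<in> space P. ennreal \<delta> <
      (SUP t\<in>{0..T}. ennreal \<bar>(LINT s:{0..t}|lborel. X s \<omega> * ((stopped_at T B (s + \<epsilon>) \<omega> - stopped_at T B s \<omega>) / \<epsilon>)) -
        (X t \<omega> - X 0 \<omega> - \<mu> * (LINT s:{0..t}|lborel. X s \<omega>)) / \<sigma>\<bar>)}) \<longlongrightarrow> 0) (at_right 0)"
      by (simp only: F_def[abs_def])
  qed
qed

text \<open>The forward integral was chosen so that the equation holds identically. What remains is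
  membership in the class: the value at \<open>t\<close> is, up to a null set, a Borel function of
  \<open>B T\<close> and \<open>B t\<close>.\<close>

lemma solves_forward_eq_exp:
  fixes \<mu> \<sigma> :: real and g :: "real \<Rightarrow> real"
  assumes \<sigma>: "\<sigma> > 0" and g[measurable]: "g \<in> borel_measurable borel"
  shows "solves_forward_eq P T B \<mu> \<sigma> (\<lambda>\<omega>. g (B T \<omega>))
    (\<lambda>t \<omega>. g (B T \<omega>) * exp (\<sigma> * b t \<omega> + (\<mu> - \<sigma>\<^sup>2 / 2) * t))"
proof -
  have B_meas: "B t \<in> borel_measurable P" if "t \<in> {0..T}" for t
    using bm that by (simp add: brownian_motion_def process_on_def)
  have [measurable]: "B T \<in> borel_measurable P" using T_pos by (intro B_meas) auto
  define X where "X t \<omega> = g (B T \<omega>) * exp (\<sigma> * b t \<omega> + (\<mu> - \<sigma>\<^sup>2 / 2) * t)" for t \<omega>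
  have cX: "continuous_on UNIV (\<lambda>t. X t \<omega>)" for \<omega> unfolding X_def by (intro continuous_intros)
  have adapted: "\<exists>Y \<in> borel_measurable (insider_info P T B t). AE \<omega> in P. X t \<omega> = Y \<omega>" if t: "t \<in> {0..T}" for t
  proof -
    have Bi: "B s \<in> borel_measurable (insider_info P T B t)" if s: "s \<in> insert T {0..t}" for s
    proof (rule measurableI)
      fix A :: "real set" assume "A \<in> sets borel"
      then have "B s -` A \<inter> space P \<in> {B s -` A \<inter> space P | s A. s \<in> insert T {0..t} \<and> A \<in> sets borel}"
        using s by blast
      moreover have "{B s -` A \<inter> space P | s A. s \<in> insert T {0..t} \<and> A \<in> sets borel} \<subseteq> Pow (space P)" by auto
      ultimately show "B s -` A \<inter> space (insider_info P T B t) \<in> sets (insider_info P T B t)"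
        unfolding insider_info_def by (simp add: space_measure_of sets_measure_of)
    qed auto
    have [measurable]: "B T \<in> borel_measurable (insider_info P T B t)" "B t \<in> borel_measurable (insider_info P T B t)"
      using t by (auto intro: Bi)
    have "(\<lambda>\<omega>. g (B T \<omega>) * exp (\<sigma> * B t \<omega> + (\<mu> - \<sigma>\<^sup>2 / 2) * t)) \<in> borel_measurable (insider_info P T B t)"
      by measurable
    moreover have "AE \<omega> in P. X t \<omega> = g (B T \<omega>) * exp (\<sigma> * B t \<omega> + (\<mu> - \<sigma>\<^sup>2 / 2) * t)"
      using b_eq t by (auto simp: X_def)
    ultimately show ?thesis by (intro bexI[where x="\<lambda>\<omega>. g (B T \<omega>) * exp (\<sigma> * B t \<omega> + (\<mu> - \<sigma>\<^sup>2 / 2) * t)"])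
  qed
  have "AE \<omega> in P. B 0 \<omega> = 0" using bm by (simp add: brownian_motion_def)
  then have init: "AE \<omega> in P. X 0 \<omega> = g (B T \<omega>)"
    using b_eq by eventually_elim (use T_pos in \<open>auto simp: X_def\<close>)
  have "solves_forward_eq P T B \<mu> \<sigma> (\<lambda>\<omega>. g (B T \<omega>)) X"
    unfolding solves_forward_eq_def
  proof (intro conjI ballI)
    show "process_on P {0..T} X" unfolding process_on_def X_def by measurable
    show "AE \<omega> in P. set_integrable lborel {0..T} (\<lambda>s. X s \<omega>)"
      by (intro AE_I2 borel_integrable_atLeastAtMost' continuous_on_subset[OF cX]) auto
    show "\<exists>I. has_forward_integral P (stopped_at T B) 0 T X I \<and>
      (AE \<omega> in P. \<forall>t\<in>{0..T}. X t \<omega> = X 0 \<omega> + \<mu> * (LINT s:{0..t}|lborel. X s \<omega>) + \<sigma> * I t \<omega>)"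
      using \<sigma> has_forward_integral_exp[OF \<sigma>, of "\<lambda>\<omega>. g (B T \<omega>)" \<mu>]
      by (intro exI[of _ "\<lambda>t \<omega>. (X t \<omega> - X 0 \<omega> - \<mu> * (LINT s:{0..t}|lborel. X s \<omega>)) / \<sigma>"])
        (auto simp: X_def[abs_def])
  qed (fact adapted init)+
  then show ?thesis by (simp add: X_def[abs_def])
qed

end

section \<open>Expected terminal wealth\<close>

lemma solves_bank_ode_terminal:
  assumes X: "solves_bank_ode P T \<rho> \<xi> X" and T: "T > 0"
  shows "AE \<omega> in P. X T \<omega> = \<xi> \<omega> * exp (\<rho> * T)"
proof -
  have "AE \<omega> in P. X 0 \<omega> = \<xi> \<omega> \<and>
        (\<forall>t\<in>{0..T}. ((\<lambda>u. X u \<omega>) has_real_derivative \<rho> * X t \<omega>) (at t within {0..T}))"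
    using X by (simp add: solves_bank_ode_def)
  then show ?thesis
  proof eventually_elim
    case (elim \<omega>)
    \<comment> \<open>With the integrating factor \<open>exp (- \<rho> * u)\<close> the solution
      becomes constant.\<close>
    have "((\<lambda>u. X u \<omega> * exp (- \<rho> * u)) has_real_derivative 0) (at t within {0..T})" if "t \<in> {0..T}" for t
      using elim that by (auto intro!: derivative_eq_intros simp: algebra_simps)
    then obtain c where c: "\<And>t. t \<in> {0..T} \<Longrightarrow> X t \<omega> * exp (- \<rho> * t) = c"
      using has_field_derivative_zero_constant[of "{0..T}" "\<lambda>u. X u \<omega> * exp (- \<rho> * u)"] by auto
    have "X T \<omega> * exp (- \<rho> * T) = \<xi> \<omega>"
      using c[of T] c[of 0] T elim by auto
    then show ?case by (auto simp: exp_minus field_simps)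
  qed
qed

text \<open>Completing the square; the Gaussian case of the Cameron-Martin shift.\<close>

lemma normal_density_exp_tilt:
  fixes \<sigma> T x :: real
  assumes "T > 0"
  shows "normal_density 0 (sqrt T) x * exp (\<sigma> * x - \<sigma>\<^sup>2 / 2 * T) = normal_density (\<sigma> * T) (sqrt T) x"
proof -
  have "exp (- (x\<^sup>2 / (2 * T))) * exp (\<sigma> * x - \<sigma>\<^sup>2 / 2 * T) = exp (- ((x - \<sigma> * T)\<^sup>2 / (2 * T)))"
    unfolding exp_add[symmetric] using assms
    by (intro arg_cong[of _ _ exp]) (simp add: field_simps power2_eq_square)
  then show ?thesis using assms by (simp add: normal_density_def)
qed

section \<open>Maximising a linear functional over strategies\<close>

lemma strategiesD:
  assumes "f \<in> strategies"
  shows "f \<in> borel_measurable borel" "AE x in lborel. 0 \<le> f x \<and> f x \<le> 1"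
  using assms by (auto simp: strategies_def L_infinity_def)

lemma indicator_in_strategies:
  assumes "S \<in> sets borel"
  shows "indicat_real S \<in> strategies"
  unfolding strategies_def L_infinity_def using assms
  by (auto intro!: exI[of _ 1] AE_I2 split: split_indicator)

lemma integrable_strategy_mult:
  assumes f: "f \<in> strategies" and w: "integrable lborel w"
  shows "integrable lborel (\<lambda>x. f x * (w x :: real))"
proof (rule Bochner_Integration.integrable_bound[OF w])
  show "(\<lambda>x. f x * w x) \<in> borel_measurable lborel"
    using strategiesD(1)[OF f] borel_measurable_integrable[OF w] by measurable
  show "AE x in lborel. norm (f x * w x) \<le> norm (w x)"
    using strategiesD(2)[OF f] by eventually_elim (auto simp: abs_mult mult_left_le_one_le)
qed

text \<open>A linear functional of functions with values between 0 and 1 is maximised pointwise, by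
  1 where the weight is positive and 0 where it is negative. The loss
  \<open>(?o x - f x) * w x\<close> is nonnegative almost everywhere, so a maximiser makes it vanish
  almost everywhere, and \<open>w\<close> is nonzero off the null point \<open>a\<close>, where its
  sign is left open.\<close>

lemma is_arg_max_weighted_integral:
  fixes w :: "real \<Rightarrow> real" and J :: "(real \<Rightarrow> real) \<Rightarrow> real"
  assumes w: "integrable lborel w" "\<And>x. x > a \<Longrightarrow> w x > 0" "\<And>x. x < a \<Longrightarrow> w x < 0"
    and J: "\<And>f. f \<in> strategies \<Longrightarrow> J f = C + (LINT x|lborel. f x * w x)"
  shows "is_arg_max J (\<lambda>g. g \<in> strategies) f \<longleftrightarrow>
    f \<in> strategies \<and> (AE x in lborel. f x = indicat_real {x. x > a} x)"
proof -
  let ?o = "indicat_real {x. x > a}"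
  have o: "?o \<in> strategies" by (intro indicator_in_strategies) simp
  have gap_nonneg: "AE x in lborel. 0 \<le> (?o x - f x) * w x" if f: "f \<in> strategies" for f
    using strategiesD(2)[OF f] AE_lborel_singleton[of a]
  proof eventually_elim
    case (elim x)
    then show ?case using w(2)[of x] w(3)[of x]
      by (cases "x > a") (auto simp: mult_nonneg_nonneg mult_nonneg_nonpos less_imp_le intro!: mult_nonpos_nonpos)
  qed
  have gap_int: "integrable lborel (\<lambda>x. (?o x - f x) * w x)"
    and gap: "J ?o - J f = (LINT x|lborel. (?o x - f x) * w x)" if f: "f \<in> strategies" for f
    using integrable_strategy_mult[OF f w(1)] integrable_strategy_mult[OF o w(1)]
    by (auto simp: J[OF f] J[OF o] left_diff_distrib)
  have opt: "J f \<le> J ?o" if f: "f \<in> strategies" for f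
    using gap[OF f] integral_nonneg_AE[OF gap_nonneg[OF f]] by simp
  show ?thesis
  proof
    assume m: "is_arg_max J (\<lambda>g. g \<in> strategies) f"
    then have f: "f \<in> strategies" and "J ?o \<le> J f" using o by (auto simp: is_arg_max_def not_less)
    with opt[OF f] gap[OF f] have "(LINT x|lborel. (?o x - f x) * w x) = 0" by simp
    then have "AE x in lborel. (?o x - f x) * w x = 0"
      using integral_nonneg_eq_0_iff_AE[OF gap_int[OF f] gap_nonneg[OF f]] by simp
    then have "AE x in lborel. f x = ?o x"
      using AE_lborel_singleton[of a]
    proof eventually_elim
      case (elim x)
      then show ?case using w(2)[of x] w(3)[of x] by (cases "x > a") auto
    qed
    then show "f \<in> strategies \<and> (AE x in lborel. f x = ?o x)" using f by simp
  next
    assume a: "f \<in> strategies \<and> (AE x in lborel. f x = ?o x)"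
    then have "(LINT x|lborel. f x * w x) = (LINT x|lborel. ?o x * w x)"
      using strategiesD(1)[of f] strategiesD(1)[OF o] borel_measurable_integrable[OF w(1)]
      by (intro integral_cong_AE) (auto elim: AE_mp)
    then have "J f = J ?o" using J a o by simp
    then show "is_arg_max J (\<lambda>g. g \<in> strategies) f"
      using a opt by (auto simp: is_arg_max_def not_less)
  qed
qed

theorem theorem3p2:
  fixes P :: "'a measure" and B :: "real \<Rightarrow> 'a \<Rightarrow> real"
    and T M \<rho> \<mu> \<sigma> :: real
    and S0 S1 :: "(real \<Rightarrow> real) \<Rightarrow> real \<Rightarrow> 'a \<Rightarrow> real"
  assumes "T > 0" and "M > 0" and "\<rho> > 0" and "\<mu> > 0" and "\<sigma> > 0" and "\<mu> > \<rho>"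
    and "brownian_motion P T B"
    and "\<And>f. f \<in> strategies \<Longrightarrow>
           solves_bank_ode P T \<rho> (\<lambda>\<omega>. M * (1 - f (B T \<omega>))) (S0 f)"
    and "\<And>f. f \<in> strategies \<Longrightarrow>
           unique_solution_forward_eq P T B \<mu> \<sigma> (\<lambda>\<omega>. M * f (B T \<omega>)) (S1 f)"
  shows "(\<forall>f\<in>strategies. integrable P (terminal_wealth T (S0 f) (S1 f))) \<and>
         indicat_real {x. x > T / \<sigma> * (\<rho> - \<mu> + 1 / 2 * \<sigma>\<^sup>2)} \<in> strategies \<and>
         (\<forall>f. is_arg_max
                (\<lambda>g. prob_space.expectation P (terminal_wealth T (S0 g) (S1 g)))
                (\<lambda>g. g \<in> strategies) f \<longleftrightarrow>
              f \<in> strategies \<and>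
              (AE x in lborel. f x = indicat_real {x. x > T / \<sigma> * (\<rho> - \<mu> + 1 / 2 * \<sigma>\<^sup>2)} x))"
proof -
  obtain b where "continuous_version P T B b"
    using exists_continuous_version assms(1,7) by blast
  then interpret V: continuous_version P T B b .
  \<comment> \<open>The Gaussian law is given for increments, and \<open>B 0 = 0\<close> holds only
    almost surely; \<open>Z\<close> has the exact law and agrees with \<open>B T\<close> off a null
    set.\<close>
  define Z where "Z \<omega> = B T \<omega> - B 0 \<omega>" for \<omega>
  define n0 where "n0 = normal_density 0 (sqrt T)"
  define n1 where "n1 = normal_density (\<sigma> * T) (sqrt T)"
  define a where "a = T / \<sigma> * (\<rho> - \<mu> + 1 / 2 * \<sigma>\<^sup>2)"
  \<comment> \<open>The expected gain, per unit of \<open>f\<close> and of Lebesgue measure at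
    \<open>B T = x\<close>, of holding the wealth in stock instead of the bank. The stock part has
    the tilted density \<open>n1\<close>, whose total weight is the mean growth
    \<open>exp (\<mu> * T)\<close>.\<close>
  define w where "w x = M * (exp (\<mu> * T) * n1 x - exp (\<rho> * T) * n0 x)" for x
  define pay where "pay f x = M * (1 - f x) * exp (\<rho> * T) + M * f x * exp (\<sigma> * x + (\<mu> - \<sigma>\<^sup>2 / 2) * T)"
    for f :: "real \<Rightarrow> real" and x
  have B_meas: "B 0 \<in> borel_measurable P" "B T \<in> borel_measurable P"
    using assms(1,7) by (auto simp: brownian_motion_def process_on_def)
  then have Z_meas[measurable]: "Z \<in> borel_measurable P" unfolding Z_def by measurable
  have dist_Z: "distributed P lborel Z n0"
    using assms(1,7) unfolding brownian_motion_def Z_def[abs_def] n0_def by force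
  have "AE \<omega> in P. B 0 \<omega> = 0" using assms(7) by (simp add: brownian_motion_def)
  then have Z_AE: "AE \<omega> in P. B T \<omega> = Z \<omega> \<and> b T \<omega> = Z \<omega>"
    using V.b_eq by eventually_elim (use assms(1) in \<open>auto simp: Z_def\<close>)
  have tilt: "n0 x * exp (\<sigma> * x + (\<mu> - \<sigma>\<^sup>2 / 2) * T) = exp (\<mu> * T) * n1 x" for x
  proof -
    have "exp (\<sigma> * x + (\<mu> - \<sigma>\<^sup>2 / 2) * T) = exp (\<mu> * T) * exp (\<sigma> * x - \<sigma>\<^sup>2 / 2 * T)"
      unfolding exp_add[symmetric] by (simp add: algebra_simps)
    then show ?thesis
      using normal_density_exp_tilt[OF assms(1), of x \<sigma>] by (simp add: n0_def n1_def)
  qed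
  have int_n0: "integrable lborel n0" and int_w: "integrable lborel w"
    unfolding w_def n0_def n1_def using assms(1) by auto
  have int_n0_1: "(LINT x|lborel. n0 x) = 1" unfolding n0_def using assms(1) by simp
  have w_n0: "w x = M * n0 x * (exp (\<sigma> * x + (\<mu> - \<sigma>\<^sup>2 / 2) * T) - exp (\<rho> * T))" for x
    unfolding w_def tilt[symmetric] by (simp add: algebra_simps)
  have n0_pos: "M * n0 x > 0" for x using assms(1,2) by (simp add: n0_def normal_density_pos)
  have threshold: "\<rho> * T < \<sigma> * x + (\<mu> - \<sigma>\<^sup>2 / 2) * T \<longleftrightarrow> x > a"
    "\<sigma> * x + (\<mu> - \<sigma>\<^sup>2 / 2) * T < \<rho> * T \<longleftrightarrow> x < a" for x
    using assms(5) unfolding a_def by (auto simp: field_simps)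
  have w_sign: "w x > 0" if "x > a" for x
    unfolding w_n0 by (rule mult_pos_pos[OF n0_pos]) (use threshold(1)[of x] that in simp)
  have w_sign': "w x < 0" if "x < a" for x
    unfolding w_n0 by (rule mult_pos_neg[OF n0_pos]) (use threshold(2)[of x] that in simp)
  have pay_n0: "n0 x * pay f x = M * exp (\<rho> * T) * n0 x + f x * w x" for f x
    unfolding pay_def w_def tilt[symmetric] by (simp add: algebra_simps)
  have pay_meas: "pay f \<in> borel_measurable borel" if "f \<in> strategies" for f
    using strategiesD(1)[OF that] unfolding pay_def by measurable
  have pay_int: "integrable lborel (\<lambda>x. n0 x * pay f x)"
    and pay_val: "(LINT x|lborel. n0 x * pay f x) = M * exp (\<rho> * T) + (LINT x|lborel. f x * w x)"
    if "f \<in> strategies" for f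
    using integrable_strategy_mult[OF that int_w] int_n0 int_n0_1 unfolding pay_n0 by auto
  have wealth_meas: "terminal_wealth T (S0 f) (S1 f) \<in> borel_measurable P"
    and wealth_AE: "AE \<omega> in P. terminal_wealth T (S0 f) (S1 f) \<omega> = pay f (Z \<omega>)" if f: "f \<in> strategies" for f
  proof -
    note bank = assms(8)[OF f] and stock = assms(9)[OF f]
    have "S0 f T \<in> borel_measurable P" "S1 f T \<in> borel_measurable P"
      using bank stock assms(1)
      by (auto simp: solves_bank_ode_def unique_solution_forward_eq_def solves_forward_eq_def process_on_def)
    then show "terminal_wealth T (S0 f) (S1 f) \<in> borel_measurable P"
      unfolding terminal_wealth_def by measurable
    \<comment> \<open>The explicit solution lies in the class, so the uniqueness built into the
      hypothesis on \<open>S1 f\<close> identifies the two on all of \<open>{0..T}\<close>.\<close>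
    have "solves_forward_eq P T B \<mu> \<sigma> (\<lambda>\<omega>. M * f (B T \<omega>))
        (\<lambda>t \<omega>. M * f (B T \<omega>) * exp (\<sigma> * b t \<omega> + (\<mu> - \<sigma>\<^sup>2 / 2) * t))"
      using strategiesD(1)[OF f] by (intro V.solves_forward_eq_exp[of \<sigma> "\<lambda>x. M * f x"] assms(5)) measurable
    then have "AE \<omega> in P. \<forall>t\<in>{0..T}. M * f (B T \<omega>) * exp (\<sigma> * b t \<omega> + (\<mu> - \<sigma>\<^sup>2 / 2) * t) = S1 f t \<omega>"
      using stock unfolding unique_solution_forward_eq_def by blast
    then show "AE \<omega> in P. terminal_wealth T (S0 f) (S1 f) \<omega> = pay f (Z \<omega>)"
      using solves_bank_ode_terminal[OF bank assms(1)] Z_AE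
    proof eventually_elim
      case (elim \<omega>)
      have "S1 f T \<omega> = M * f (Z \<omega>) * exp (\<sigma> * Z \<omega> + (\<mu> - \<sigma>\<^sup>2 / 2) * T)"
        using bspec[OF elim(1), of T] elim(3) assms(1) by simp
      then show ?case using elim by (simp add: terminal_wealth_def pay_def)
    qed
  qed
  have n0_nonneg: "0 \<le> n0 x" for x by (simp add: n0_def)
  have wealth_int: "integrable P (terminal_wealth T (S0 f) (S1 f))" if f: "f \<in> strategies" for f
  proof -
    have [measurable]: "pay f \<in> borel_measurable borel" by (rule pay_meas[OF f])
    have "integrable P (\<lambda>\<omega>. pay f (Z \<omega>))"
      using distributed_integrable[OF dist_Z, of "pay f"] pay_int[OF f] pay_meas[OF f] n0_nonneg by simp
    then show ?thesis
      using wealth_AE[OF f] wealth_meas[OF f] by (subst integrable_cong_AE[where g="\<lambda>\<omega>. pay f (Z \<omega>)"]) auto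
  qed
  have J: "V.expectation (terminal_wealth T (S0 f) (S1 f)) = M * exp (\<rho> * T) + (LINT x|lborel. f x * w x)"
    if f: "f \<in> strategies" for f
  proof -
    have [measurable]: "pay f \<in> borel_measurable borel" by (rule pay_meas[OF f])
    have "V.expectation (terminal_wealth T (S0 f) (S1 f)) = V.expectation (\<lambda>\<omega>. pay f (Z \<omega>))"
      using wealth_AE[OF f] wealth_meas[OF f] by (intro integral_cong_AE) auto
    also have "\<dots> = (LINT x|lborel. n0 x * pay f x)"
      using distributed_integral[OF dist_Z, of "pay f"] pay_meas[OF f] n0_nonneg by simp
    finally show ?thesis using pay_val[OF f] by simp
  qed
  show ?thesis
    unfolding a_def[symmetric]
    using wealth_int indicator_in_strategies[of "{x. x > a}"]
      is_arg_max_weighted_integral[OF int_w w_sign w_sign' J]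
    by auto
qed

end
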